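(* Let $s\geq 2$ be an integer, $m=2s$, $q=2^m$, let $l$ be an integer with $1\leq l\leq m-1$ and $l\neq s$, and put $d=\gcd(s,l)$, $d'=\gcd(s+l,2l)$. Let $$\overline{\mathcal{C}_2^{\bot}}^{\bot}=\{(\mathrm{Tr}_1^s(ax^{2^s+1})+\mathrm{Tr}_1^m(bx^{2^l+1}+cx)+h)_{x\in\mathbb{F}_q}: a\in\mathbb{F}_{2^s},\ b,c\in\mathbb{F}_q,\ h\in\mathbb{F}_2\}.$$ For every $i\ge 1$ such that this code contains a codeword of weight $i$, the supports of the codewords of weight $i$ form the block set of a $2$-design on the set $\mathcal{P}$ of the $2^m$ coordinate positions. Moreover, for each of the following pairs $(i,\lambda)$, the supports of the codewords of weight $i$ form a $2$-$(2^m,i,\lambda)$ design. (1) If $d'=d$: - $i=2^{2s-1}-2^{s-1}$, $\lambda=\dfrac{2^{s-1}(2^s-1)(2^{2s-1}-2^{s-1}-1)(2^{2(s+d)}-2^{2s+d}-2^{2s}+2^{s+2d}-2^{s+d}+2^{2d})}{(2^{2d}-1)(2^s+1)}$; - $i=2^{2s-1}+2^{s-1}$, $\lambda=\dfrac{2^{s-1}(2^{2s-1}+2^{s-1}-1)(2^{2(s+d)}-2^{2s+d}-2^{2s}+2^{s+2d}-2^{s+d}+2^{2d})}{2^{2d}-1}$; - $i=2^{2s-1}-2^{s+d-1}$, $\lambda=\dfrac{2^{s-d-1}(2^{s-d}-1)(2^{s+d}-1)(2^{2s-1}-2^{s+d-1}-1)}{2^{2d}-1}$; - $i=2^{2s-1}+2^{s+d-1}$,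 $\lambda=\dfrac{2^{s-d-1}(2^{s-d}+1)(2^{s+d}-1)(2^{2s-1}+2^{s+d-1}-1)}{2^{2d}-1}$; - $i=2^{2s-1}$, $\lambda=(2^{2s-1}-1)(2^{3s-d}-2^{2s-2d}+1)$. (2) If $d'=2d$: - $i=2^{2s-1}-2^{s-1}$, $\lambda=\dfrac{2^{3d}(2^{2s}-2^{2(s-d)}-2^{2s-3d}+2^s-2^{s-d}+1)(2^{2s-1}-2^{s-1}-1)(2^{2s-1}-2^{s-1})}{(2^{2d}-1)(2^d+1)(2^s+1)}$; - $i=2^{2s-1}+2^{s-1}$, $\lambda=\dfrac{2^{3d}(2^{2s}-2^{2(s-d)}-2^{2s-3d}+2^s-2^{s-d}+1)(2^{2s-1}+2^{s-1}-1)(2^{2s-1}+2^{s-1})}{(2^{2d}-1)(2^d+1)(2^s+1)}$; - $i=2^{2s-1}-2^{s+d-1}$, $\lambda=\dfrac{(2^s+2^{s-d}+2^{s-2d}+1)(2^{2s-1}-2^{s+d-1})(2^{2s-1}-2^{s+d-1}-1)}{2^d(2^d+1)^2}$; - $i=2^{2s-1}+2^{s+d-1}$, $\lambda=\dfrac{(2^s+2^{s-d}+2^{s-2d}+1)(2^{2s-1}+2^{s+d-1})(2^{2s-1}+2^{s+d-1}-1)}{2^d(2^d+1)^2}$; - $i=2^{2s-1}$, $\lambda=(2^{2s-1}-1)(2^{3s-d}-2^{3s-2d}+2^{3s-3d}-2^{3s-4d}+2^{3s-5d}+2^{2s-d}-2^{2s-2d+1}+2^{2s-3d}-2^{2s-4d}+1)$;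 - $i=2^{2s-1}-2^{s+2d-1}$, $\lambda=\dfrac{(2^{s-d}-1)(2^{2s-1}-2^{s+2d-1})(2^{2s-1}-2^{s+2d-1}-1)}{2^{4d}(2^d+1)(2^{2d}-1)}$; - $i=2^{2s-1}+2^{s+2d-1}$, $\lambda=\dfrac{(2^{s-d}-1)(2^{2s-1}+2^{s+2d-1})(2^{2s-1}+2^{s+2d-1}-1)}{2^{4d}(2^d+1)(2^{2d}-1)}$.
   Context: $\mathbb{F}_q$ is the finite field with $q=2^m$ elements; $\mathrm{Tr}_1^m$ and $\mathrm{Tr}_1^s$ are the trace functions from $\mathbb{F}_{2^m}$ and $\mathbb{F}_{2^s}$, respectively, onto $\mathbb{F}_2$ (note $x^{2^s+1}\in\mathbb{F}_{2^s}$ for $x\in\mathbb{F}_q$). The coordinate positions of the code are indexed by $\mathbb{F}_q$, identified by a fixed bijection with $\mathcal{P}=\{0,1,\ldots,2^m-1\}$. The support of a codeword is the set of positions where it is nonzero. For $1\le t\le k\le v$, a $t$-$(v,k,\lambda)$ design is a pair $(\mathcal{P},\mathcal{B})$ where $\mathcal{P}$ is a set of $v$ points and $\mathcal{B}$ is a set of $k$-subsets (blocks) of $\mathcal{P}$ such that every $t$-subset of $\mathcal{P}$ is contained in exactly $\lambda$ elements of $\mathcal{B}$; the case $k=v$ is a trivial design. A $t$-design is a $t$-$(v,k,\lambda)$ design for some $v,k,\lambda$. *)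

theory Defs
  imports
    "HOL-Computational_Algebra.Computational_Algebra"
    "HOL-Number_Theory.Residues"
    "HOL-Library.Cardinality"
begin

(* The ambient field of order 2^m is a type 'a :: finite_field with CARD('a) = 2^m; the prime
   field of order 2 is its subset {0, 1}. *)

text \<open>The subfield of order \<open>2 ^ k\<close> (for \<open>k\<close> dividing \<open>m\<close>) is the fixed field of
  \<open>x \<mapsto> x ^ (2 ^ k)\<close>.\<close>

definition subfield2 :: "nat \<Rightarrow> 'a::finite_field set" where
  "subfield2 k = {x. x ^ (2 ^ k) = x}"

text \<open>The absolute trace of the field of order \<open>2 ^ k\<close>, to be applied to elements of
  \<open>subfield2 k\<close> only.\<close>

definition tr :: "nat \<Rightarrow> 'a::finite_field \<Rightarrow> 'a" where
  "tr k x = (\<Sum>j<k. x ^ (2 ^ j))"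

definition trace_code :: "nat \<Rightarrow> nat \<Rightarrow> ('a::finite_field \<Rightarrow> 'a) set" where
  "trace_code s l =
    {\<lambda>x. tr s (a * x ^ (2 ^ s + 1)) + tr (2 * s) (b * x ^ (2 ^ l + 1) + c * x) + h | a b c h.
      a \<in> subfield2 s \<and> h \<in> {0, 1}}"

text \<open>The map \<open>pos\<close> numbers the coordinates.\<close>

definition supp :: "('a \<Rightarrow> nat) \<Rightarrow> ('a \<Rightarrow> 'b::zero) \<Rightarrow> nat set" where
  "supp pos w = pos ` {x. w x \<noteq> 0}"

definition weight :: "('a \<Rightarrow> 'b::zero) \<Rightarrow> nat" where
  "weight w = card {x. w x \<noteq> 0}"

definition weight_supports :: "('a \<Rightarrow> nat) \<Rightarrow> ('a \<Rightarrow> 'b::zero) set \<Rightarrow> nat \<Rightarrow> nat set set" where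
  "weight_supports pos C i = supp pos ` {w \<in> C. weight w = i}"

definition design :: "nat \<Rightarrow> nat \<Rightarrow> nat \<Rightarrow> nat \<Rightarrow> 'p set \<Rightarrow> 'p set set \<Rightarrow> bool" where
  "design t v k lam P B \<longleftrightarrow>
    1 \<le> t \<and> t \<le> k \<and> k \<le> v \<and>
    finite P \<and> card P = v \<and>
    (\<forall>b\<in>B. b \<subseteq> P \<and> card b = k) \<and>
    (\<forall>T. T \<subseteq> P \<and> card T = t \<longrightarrow> card {b \<in> B. T \<subseteq> b} = lam)"

definition t_design :: "nat \<Rightarrow> 'p set \<Rightarrow> 'p set set \<Rightarrow> bool" where
  "t_design t P B \<longleftrightarrow> (\<exists>v k lam. design t v k lam P B)"

lemma CHAR_eq_2:
  assumes "CARD('a::finite_field) = 2 ^ m"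
  shows "CHAR('a) = 2"
proof -
  have "CHAR('a) dvd 2 ^ m"
    using CHAR_dvd_CARD[where 'a = 'a] assms by simp
  moreover have "prime CHAR('a)"
    by (rule prime_CHAR_semidom) (simp add: finite_imp_CHAR_pos)
  ultimately show ?thesis
    using prime_dvd_power primes_dvd_imp_eq two_is_prime_nat by blast
qed

lemma add_power_2:
  fixes x y :: "'a::finite_field"
  assumes "CHAR('a) = 2"
  shows "(x + y) ^ (2 ^ k) = x ^ (2 ^ k) + y ^ (2 ^ k)"
  using freshmans_dream'[where 'a = 'a and x = x and y = y and m = "2 ^ k" and n = k] assms
  by simp

lemma add_self_eq_0:
  fixes x :: "'a::finite_field"
  assumes "CHAR('a) = 2"
  shows "x + x = 0"
proof -
  have "of_nat 2 = (0 :: 'a)"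
    using of_nat_CHAR[where 'a = 'a] assms by simp
  then show ?thesis
    by (metis mult_2 mult_zero_left of_nat_numeral)
qed

lemma subfield2_closed:
  assumes "CARD('a::finite_field) = 2 ^ m"
  shows "0 \<in> (subfield2 k :: 'a set)" "1 \<in> (subfield2 k :: 'a set)"
    and "x \<in> subfield2 k \<Longrightarrow> y \<in> subfield2 k \<Longrightarrow> x + y \<in> (subfield2 k :: 'a set)"
    and "x \<in> subfield2 k \<Longrightarrow> y \<in> subfield2 k \<Longrightarrow> x * y \<in> (subfield2 k :: 'a set)"
    and "x \<in> subfield2 k \<Longrightarrow> - x \<in> (subfield2 k :: 'a set)"
    and "x \<in> subfield2 k \<Longrightarrow> inverse x \<in> (subfield2 k :: 'a set)"
proof -
  note ch = CHAR_eq_2[OF assms]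
  have neg: "- x = x" for x :: 'a
    using add_self_eq_0[OF ch, of x] by (simp add: neg_eq_iff_add_eq_0)
  show "0 \<in> (subfield2 k :: 'a set)" "1 \<in> (subfield2 k :: 'a set)"
    by (auto simp: subfield2_def power_0_left)
  show "x \<in> subfield2 k \<Longrightarrow> y \<in> subfield2 k \<Longrightarrow> x + y \<in> (subfield2 k :: 'a set)"
    by (simp add: subfield2_def add_power_2[OF ch])
  show "x \<in> subfield2 k \<Longrightarrow> y \<in> subfield2 k \<Longrightarrow> x * y \<in> (subfield2 k :: 'a set)"
    by (simp add: subfield2_def power_mult_distrib)
  show "x \<in> subfield2 k \<Longrightarrow> - x \<in> (subfield2 k :: 'a set)"
    by (simp add: neg)
  show "x \<in> subfield2 k \<Longrightarrow> inverse x \<in> (subfield2 k :: 'a set)"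
    by (simp add: subfield2_def power_inverse)
qed

lemma subfield2_UNIV:
  assumes "CARD('a::finite_field) = 2 ^ m"
  shows "(subfield2 m :: 'a set) = UNIV"
  using finite_field_power_card_eq_same[where 'a = 'a] assms by (auto simp: subfield2_def)

lemma card_subfield2:
  assumes card: "CARD('a::finite_field) = 2 ^ (2 * s)" and "s > 0"
  shows "card (subfield2 s :: 'a set) = 2 ^ s"
proof (rule antisym)
  note ch = CHAR_eq_2[OF card]
  let ?K = "subfield2 s :: 'a set"
  define p where "p = Polynomial.monom (1 :: 'a) (2 ^ s) - Polynomial.monom 1 1"
  have "(1 :: nat) < 2 ^ s"
    using \<open>s > 0\<close> by (intro one_less_power) auto
  then have cf: "Polynomial.coeff p (2 ^ s) = 1"
    by (simp add: p_def)
  then have "p \<noteq> 0"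
    by auto
  moreover have "Polynomial.degree p \<le> 2 ^ s"
    unfolding p_def by (rule degree_diff_le) (auto simp: degree_monom_eq)
  moreover have "?K = {x. poly p x = 0}"
    by (auto simp: subfield2_def p_def poly_monom)
  ultimately show "card ?K \<le> 2 ^ s"
    using card_poly_roots_bound[of p] by simp
  define g where "g x = x + x ^ (2 ^ s)" for x :: 'a
  have add: "g (x + y) = g x + g y" for x y
    by (simp add: g_def add_power_2[OF ch] algebra_simps)
  have "x ^ (2 ^ (2 * s)) = x" for x :: 'a
    using finite_field_power_card_eq_same[of x] card by simp
  then have "g x \<in> ?K" for x
    by (simp add: g_def subfield2_def add_power_2[OF ch] add.commute mult_2 power_add
        flip: power_mult)
  then have "(UNIV :: 'a set) = (\<Union>y\<in>?K. {x. g x = y})"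
    by auto
  then have "2 ^ (2 * s) = card (\<Union>y\<in>?K. {x. g x = y})"
    using card by simp
  also have "\<dots> \<le> (\<Sum>y\<in>?K. card {x. g x = y})"
    by (rule card_UN_le) simp
  also have "\<dots> \<le> (\<Sum>y\<in>?K. card ?K)"
  proof (rule sum_mono)
    fix y
    show "card {x. g x = y} \<le> card ?K"
    proof (cases "\<exists>z. g z = y")
      case True
      then obtain z where z: "g z = y"
        by blast
      have "x + z \<in> ?K" if "g x = y" for x
      proof -
        have "g (x + z) = 0"
          using that z add add_self_eq_0[OF ch] by simp
        then have "(x + z) ^ (2 ^ s) = - (x + z)"
          unfolding g_def by (simp only: add_eq_0_iff)
        also have "\<dots> = x + z"
          using add_self_eq_0[OF ch, of "x + z"] by (simp only: neg_eq_iff_add_eq_0)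
        finally show ?thesis
          by (simp add: subfield2_def)
      qed
      then show ?thesis
        by (intro card_inj_on_le[where f = "\<lambda>x. x + z"]) (auto simp: inj_on_def)
    qed simp
  qed
  finally have "(2 ^ s)\<^sup>2 \<le> (card ?K)\<^sup>2"
    by (simp add: power2_eq_square power_add mult_2)
  then show "2 ^ s \<le> card ?K"
    by (simp add: power2_nat_le_eq_le)
qed

lemma tr_in_prime_field:
  assumes "CARD('a::finite_field) = 2 ^ m" and x: "x \<in> (subfield2 k :: 'a set)"
  shows "tr k x \<in> {0, 1}"
proof -
  note ch = CHAR_eq_2[OF assms(1)]
  have "(tr k x)\<^sup>2 = (\<Sum>j<k. (x ^ (2 ^ j))\<^sup>2)"
    unfolding tr_def using freshmans_dream_sum[where 'a = 'a] ch by simp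
  also have "\<dots> = (\<Sum>j<k. x ^ (2 ^ Suc j))"
    by (simp add: mult.commute flip: power_mult)
  finally have "(tr k x)\<^sup>2 + x = (\<Sum>j<Suc k. x ^ (2 ^ j))"
    by (subst sum.lessThan_Suc_shift) (simp add: add.commute)
  also have "\<dots> = tr k x + x"
    using x by (simp add: tr_def subfield2_def)
  finally have "tr k x * tr k x = tr k x"
    by (simp add: power2_eq_square)
  then show ?thesis
    by (simp add: power2_eq_square)
qed

end

theory Submission
  imports Defs
begin

text \<open>The code is invariant under the affine group of the field, which is doubly transitive, so the
  supports of weight \<open>i\<close> form a 2-design with \<open>\<lambda> q (q - 1) = A i (i - 1)\<close>, where \<open>q = 2 ^ (2 * s)\<close>
  and \<open>A\<close> counts the codewords of weight \<open>i\<close>. For a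
  fixed form \<open>Q a b\<close> the square of the exponential sum \<open>T a b c\<close> is either 0 or \<open>q\<close> times the size
  of the radical, and its sum over \<open>c\<close> is \<open>q\<^sup>2\<close>; letting \<open>h\<close> vary removes the dependence on signs.
  So \<open>A\<close> depends only on how many of the forms \<open>Q a b\<close> have a radical of a given size.

  Let \<open>\<theta>\<close> be the Frobenius power \<open>x \<mapsto> x ^ (2 ^ (s + l))\<close>. The radical is the kernel of a
  polynomial of degree two in \<open>\<theta>\<close>, hence has \<open>1\<close>, \<open>2 ^ d'\<close> or \<open>2 ^ (2 * d')\<close> elements unless
  \<open>a = b = 0\<close>. Double counting gives the sum of all radical sizes. If \<open>d' = d\<close>, the polar form is
  alternating over the field of order \<open>2 ^ d\<close>, so the middle value does not occur and two linear
  equations determine the counts. If \<open>d' = 2 * d\<close>, the form is invariant under the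
  \<open>(2 ^ d + 1)\<close>-th roots of unity, so its exponential sum is congruent to 1 modulo \<open>2 ^ d + 1\<close>;
  this fixes the sign of the sum, and the sum over all forms is the third equation.\<close>

section \<open>Subfields, traces and characters of fields of characteristic two\<close>

lemma subfield2_power_add:
  assumes "x \<in> subfield2 j"
  shows "x ^ (2 ^ (j * k + r)) = x ^ (2 ^ r)"
proof (induction k)
  case (Suc k)
  have "x ^ (2 ^ (j * Suc k + r)) = (x ^ (2 ^ j)) ^ (2 ^ (j * k + r))"
    by (simp add: power_add algebra_simps flip: power_mult)
  then show ?case
    using Suc assms by (simp add: subfield2_def)
qed simp

lemma subfield2_mult:
  assumes "x \<in> subfield2 j"
  shows "x \<in> subfield2 (j * k)"
  using subfield2_power_add[OF assms, of k 0] by (simp add: subfield2_def)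

lemma subfield2_dvd: "x \<in> subfield2 j \<Longrightarrow> j dvd k \<Longrightarrow> x \<in> subfield2 k"
  using subfield2_mult by (auto elim: dvdE)

text \<open>Euclid's algorithm on the exponents: on elements fixed by the Frobenius power
  \<open>j\<close>, an exponent matters only modulo \<open>j\<close>.\<close>

lemma subfield2_gcd:
  assumes "x \<in> subfield2 i" "x \<in> subfield2 j"
  shows "x \<in> subfield2 (gcd i j)"
  using assms
proof (induction i j rule: gcd_nat_induct)
  case (step i j)
  have "x ^ (2 ^ i) = x ^ (2 ^ (i mod j))"
    using subfield2_power_add[of x j "i div j" "i mod j"] step.prems by simp
  then have "x \<in> subfield2 (i mod j)"
    using step.prems by (simp add: subfield2_def)
  then show ?case
    using step by (metis gcd_red_nat)
qed simp

text \<open>The degree of the polynomial gives the upper bound. For the lower bound, write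
  \<open>q - 1 = n * k\<close>: raising to the power \<open>k\<close> maps the \<open>q - 1\<close>
  units into these roots, and no fibre has more than \<open>k\<close> elements.\<close>

lemma card_roots_of_unity:
  assumes n: "n dvd CARD('a::finite_field) - 1"
  shows "card {u::'a. u ^ n = 1} = n"
proof (rule antisym)
  define q where "q = CARD('a)"
  have q: "q \<ge> 2"
    using card_mono[of UNIV "{0::'a, 1}"] by (simp add: q_def)
  obtain k where k: "q - 1 = n * k"
    using n by (auto simp: q_def)
  have pos: "n > 0" "k > 0"
    using k q by (auto intro: Nat.gr0I)
  have roots: "card {u::'a. u ^ j = c} \<le> j" if "j > 0" for j c
  proof -
    define p where "p = Polynomial.monom (1 :: 'a) j - [:c:]"
    have "Polynomial.coeff p j = 1"
      using \<open>j > 0\<close> by (cases j) (auto simp: p_def)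
    then have "p \<noteq> 0" by auto
    moreover have "Polynomial.degree p \<le> j"
      unfolding p_def by (rule degree_diff_le) (auto simp: degree_monom_eq)
    moreover have "{u. u ^ j = c} = {x. poly p x = 0}"
      by (auto simp: p_def poly_monom)
    ultimately show ?thesis
      using card_poly_roots_bound[of p] by simp
  qed
  show "card {u::'a. u ^ n = 1} \<le> n"
    using roots pos by blast
  have unit: "x ^ (q - 1) = 1" if "x \<noteq> 0" for x :: 'a
  proof -
    have "x * x ^ (q - 1) = x ^ q"
      using q by (simp flip: power_Suc)
    also have "\<dots> = x"
      by (simp add: q_def finite_field_power_card_eq_same)
    finally show ?thesis
      using that by simp
  qed
  have "n * k = card (UNIV - {0::'a})"
    by (simp add: card_Diff_singleton flip: k q_def)
  also have "\<dots> = card (\<Union>u\<in>{u::'a. u ^ n = 1}. {x. x \<noteq> 0 \<and> x ^ k = u})"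
  proof -
    have "x \<in> UNIV - {0} \<longleftrightarrow> x \<in> (\<Union>u\<in>{u::'a. u ^ n = 1}. {x. x \<noteq> 0 \<and> x ^ k = u})" for x :: 'a
      using unit[of x, unfolded k] pos by (auto simp: mult.commute power_0_left simp flip: power_mult)
    then show ?thesis
      by (intro arg_cong[where f = card]) blast
  qed
  also have "\<dots> \<le> (\<Sum>u\<in>{u::'a. u ^ n = 1}. card {x. x \<noteq> 0 \<and> x ^ k = u})"
    by (rule card_UN_le) simp
  also have "\<dots> \<le> (\<Sum>u\<in>{u::'a. u ^ n = 1}. k)"
  proof (rule sum_mono)
    fix u :: 'a
    show "card {x. x \<noteq> 0 \<and> x ^ k = u} \<le> k"
      by (rule order_trans[OF card_mono roots[OF pos(2), of u]]) auto
  qed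
  finally show "n \<le> card {u::'a. u ^ n = 1}"
    using pos by simp
qed

lemma two_power_minus_one_dvd:
  assumes "k dvd n"
  shows "2 ^ k - 1 dvd (2 ^ n - 1 :: nat)"
proof -
  obtain j where n: "n = k * j"
    using assms by auto
  have "[2 ^ k = 1] (mod (2 ^ k - 1 :: nat))"
    by (simp add: cong_altdef_nat)
  then have "[(2 ^ k) ^ j = 1 ^ j] (mod (2 ^ k - 1 :: nat))"
    by (rule cong_pow)
  then show ?thesis
    by (simp add: n cong_altdef_nat flip: power_mult)
qed

text \<open>The nonzero elements are the roots of unity of order dividing \<open>2 ^ k - 1\<close>,
  a divisor of \<open>2 ^ n - 1\<close>.\<close>

lemma card_subfield2_dvd:
  assumes "CARD('a::finite_field) = 2 ^ n" "k dvd n" "k > 0"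
  shows "card (subfield2 k :: 'a set) = 2 ^ k"
proof -
  have eq: "x ^ (2 ^ k) = x * x ^ (2 ^ k - 1)" for x :: 'a
    by (simp flip: power_Suc)
  have gt: "(2::nat) ^ k > 1"
    using \<open>k > 0\<close> by (intro one_less_power) auto
  have "subfield2 k = insert 0 {u::'a. u ^ (2 ^ k - 1) = 1}"
    unfolding subfield2_def eq by auto
  moreover have "0 \<notin> {u::'a. u ^ (2 ^ k - 1) = 1}"
    using gt by (simp add: power_0_left)
  ultimately show ?thesis
    using card_roots_of_unity[where 'a = 'a, of "2 ^ k - 1"] two_power_minus_one_dvd[OF assms(2)]
      assms(1) gt by simp
qed

text \<open>The sign of a bit, integer-valued so that sums of signs can be compared by congruences.
  It is used as a character on \<open>{0, 1}\<close> only.\<close>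

definition chi :: "'a::finite_field \<Rightarrow> int" where
  "chi x = (if x = 0 then 1 else -1)"

text \<open>On the field of order \<open>2 ^ (k * n)\<close> this is the trace onto its subfield of
  order \<open>2 ^ k\<close>.\<close>

definition rel_tr :: "nat \<Rightarrow> nat \<Rightarrow> 'a::finite_field \<Rightarrow> 'a" where
  "rel_tr k n x = (\<Sum>j<n. x ^ (2 ^ (k * j)))"

lemma tr_eq_rel_tr: "tr n x = rel_tr 1 n x"
  by (simp add: tr_def rel_tr_def)

text \<open>As a polynomial the trace is nonzero of degree \<open>2 ^ (k * (n - 1))\<close>. This is
  below the order of the field, so the trace cannot vanish identically.\<close>

lemma card_rel_tr_zeros:
  assumes "n > 0" "k > 0"
  shows "card {x::'a::finite_field. rel_tr k n x = 0} \<le> 2 ^ (k * (n - 1))"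
proof -
  define p where "p = (\<Sum>j<n. Polynomial.monom (1 :: 'a) (2 ^ (k * j)))"
  have "Polynomial.coeff p (2 ^ (k * (n - 1))) = (\<Sum>j<n. if j = n - 1 then 1 else 0)"
    unfolding p_def coeff_sum using \<open>k > 0\<close> by (intro sum.cong) auto
  also have "\<dots> = 1"
    using \<open>n > 0\<close> by simp
  finally have "p \<noteq> 0" by auto
  moreover have "Polynomial.degree p \<le> 2 ^ (k * (n - 1))"
    unfolding p_def by (intro degree_sum_le) (auto simp: degree_monom_eq)
  moreover have "{x. rel_tr k n x = 0} = {x. poly p x = 0}"
    by (simp add: rel_tr_def p_def poly_sum poly_monom)
  ultimately show ?thesis
    using card_poly_roots_bound[of p] by simp
qed

section \<open>Frobenius powers, traces and orthogonality in the ambient field\<close>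

locale even_degree_field =
  fixes s :: nat and F :: "'a::finite_field itself"
  assumes card_field: "CARD('a) = 2 ^ (2 * s)" and s_pos: "s > 0"
begin

lemma char_two: "CHAR('a) = 2"
  by (rule CHAR_eq_2[OF card_field])

lemma add_self [simp]: "x + x = (0::'a)"
  by (rule add_self_eq_0[OF char_two])

lemma add_self_left [simp]: "x + (x + y) = (y::'a)"
  by (simp flip: add.assoc)

lemma add_eq_0_iff_eq: "x + y = 0 \<longleftrightarrow> x = (y::'a)"
  by (metis add_self add_self_left add.right_neutral)

lemma frobenius_add: "(x + y :: 'a) ^ (2 ^ k) = x ^ (2 ^ k) + y ^ (2 ^ k)"
  by (rule add_power_2[OF char_two])

lemma frobenius_frobenius: "((x::'a) ^ (2 ^ j)) ^ (2 ^ k) = x ^ (2 ^ (j + k))"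
  by (simp add: power_add flip: power_mult)

lemma frobenius_full: "(x::'a) ^ (2 ^ (2 * s)) = x"
  using subfield2_UNIV[OF card_field] by (auto simp: subfield2_def)

lemma frobenius_full_add: "(x::'a) ^ (2 ^ (2 * s + k)) = x ^ (2 ^ k)"
  by (simp add: frobenius_full flip: frobenius_frobenius)

lemma frobenius_double: "(x::'a) ^ (2 ^ (s + s)) = x"
  using frobenius_full by (simp add: mult_2)

lemma frobenius_sum: "(sum f A :: 'a) ^ (2 ^ k) = (\<Sum>x\<in>A. f x ^ (2 ^ k))"
  by (induction A rule: infinite_finite_induct) (simp_all add: frobenius_add power_0_left)

lemma rel_tr_add: "rel_tr k n (x + y :: 'a) = rel_tr k n x + rel_tr k n y"
  by (simp add: rel_tr_def frobenius_add sum.distrib)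

lemma rel_tr_0: "rel_tr k n (0::'a) = 0"
  by (simp add: rel_tr_def power_0_left)

lemma rel_tr_scale:
  assumes "(u::'a) \<in> subfield2 k"
  shows "rel_tr k n (u * x) = u * rel_tr k n x"
  using subfield2_power_add[OF assms, of _ 0]
  by (simp add: rel_tr_def power_mult_distrib sum_distrib_left)

text \<open>Frobenius shifts the sum of conjugates by one: \<open>x\<close> drops out and
  \<open>x ^ (2 ^ (k * n)) = x\<close> enters.\<close>

lemma rel_tr_frobenius_eq:
  assumes "(x::'a) \<in> subfield2 (k * n)"
  shows "rel_tr k n (x ^ (2 ^ k)) = rel_tr k n x"
proof -
  have "rel_tr k n (x ^ (2 ^ k)) = (\<Sum>j<n. x ^ (2 ^ (k * Suc j)))"
    by (simp add: rel_tr_def frobenius_frobenius)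
  then have "rel_tr k n (x ^ (2 ^ k)) + x = (\<Sum>j<Suc n. x ^ (2 ^ (k * j)))"
    by (subst sum.lessThan_Suc_shift) (simp add: add.commute)
  also have "\<dots> = rel_tr k n x + x"
    using assms by (simp add: rel_tr_def subfield2_def)
  finally show ?thesis by simp
qed

lemma rel_tr_in_subfield:
  assumes "(x::'a) \<in> subfield2 (k * n)"
  shows "rel_tr k n x \<in> subfield2 k"
proof -
  have "rel_tr k n x ^ (2 ^ k) = rel_tr k n (x ^ (2 ^ k))"
    by (simp add: rel_tr_def frobenius_sum frobenius_frobenius add.commute)
  then show ?thesis
    using rel_tr_frobenius_eq[OF assms] by (simp add: subfield2_def)
qed

lemma subfield2_full: "k = 2 * s \<Longrightarrow> (x::'a) \<in> subfield2 k"
  using subfield2_UNIV[OF card_field] by auto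

lemma rel_tr_frobenius:
  assumes "k * n = 2 * s"
  shows "rel_tr k n ((x::'a) ^ (2 ^ (k * j))) = rel_tr k n x"
proof (induction j)
  case (Suc j)
  have "x ^ (2 ^ (k * Suc j)) = (x ^ (2 ^ (k * j))) ^ (2 ^ k)"
    by (simp add: frobenius_frobenius add.commute)
  then show ?case
    using Suc rel_tr_frobenius_eq subfield2_full[OF assms] by metis
qed simp

text \<open>The trace has too few zeros to vanish on the whole field, so some \<open>x\<close> has
  nonzero trace, and \<open>y\<close> is the quotient of \<open>x\<close> by
  \<open>z\<close>.\<close>

lemma rel_tr_nondegenerate:
  assumes "n > 0" "k > 0" "k * n dvd 2 * s" "(z::'a) \<in> subfield2 (k * n)" "z \<noteq> 0"
  obtains y where "y \<in> subfield2 (k * n)" "rel_tr k n (y * z) \<noteq> 0"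
proof -
  have "card {x::'a. rel_tr k n x = 0} < card (subfield2 (k * n) :: 'a set)"
  proof -
    have "card {x::'a. rel_tr k n x = 0} \<le> 2 ^ (k * (n - 1))"
      using assms by (intro card_rel_tr_zeros)
    also have "\<dots> < 2 ^ (k * n)"
      using assms by (simp add: power_strict_increasing)
    also have "\<dots> = card (subfield2 (k * n) :: 'a set)"
      using card_subfield2_dvd[OF card_field assms(3)] assms by simp
    finally show ?thesis .
  qed
  then have "\<not> subfield2 (k * n) \<subseteq> {x::'a. rel_tr k n x = 0}"
    using card_mono[of "{x::'a. rel_tr k n x = 0}"] by (meson finite leD)
  then obtain x :: 'a where x: "x \<in> subfield2 (k * n)" "rel_tr k n x \<noteq> 0"
    by auto
  have "x * inverse z \<in> subfield2 (k * n)"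
    by (intro subfield2_closed(4,6)[OF card_field] x assms)
  moreover have "x * inverse z * z = x"
    using assms by simp
  ultimately show ?thesis
    using that x by metis
qed

abbreviation Tr :: "'a \<Rightarrow> 'a" where "Tr \<equiv> tr (2 * s)"

lemmas tr_add = rel_tr_add[where k = 1, folded tr_eq_rel_tr]

lemma tr_0: "tr k (0::'a) = 0"
  by (simp add: tr_eq_rel_tr rel_tr_0)

lemma Tr_frobenius: "Tr (x ^ (2 ^ j)) = Tr x"
  using rel_tr_frobenius[of 1 "2 * s" x j] by (simp add: tr_eq_rel_tr)

lemma Tr_cases: "Tr x \<in> {0, 1}"
  by (rule tr_in_prime_field[OF card_field subfield2_full]) simp

text \<open>Transitivity of the trace through the quadratic extension: the conjugates with index
  \<open>s\<close> or more are those of \<open>x ^ (2 ^ s)\<close>.\<close>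

lemma Tr_eq_tr: "Tr x = tr s (x + x ^ (2 ^ s))"
proof -
  have "tr s (x ^ (2 ^ s)) = (\<Sum>j\<in>{s..<2*s}. x ^ (2 ^ j))"
    unfolding tr_def frobenius_frobenius
    by (rule sum.reindex_bij_witness[of _ "\<lambda>j. j - s" "\<lambda>j. s + j"]) auto
  then have "tr s x + tr s (x ^ (2 ^ s)) = (\<Sum>j\<in>{0..<s}. x ^ (2 ^ j)) + (\<Sum>j\<in>{s..<2*s}. x ^ (2 ^ j))"
    by (simp add: tr_def lessThan_atLeast0)
  also have "\<dots> = Tr x"
    by (subst sum.atLeastLessThan_concat) (auto simp: tr_def lessThan_atLeast0)
  finally show ?thesis
    by (simp add: tr_add)
qed

lemma norm_in_subfield2: "(x::'a) ^ (2 ^ s + 1) \<in> subfield2 s"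
  unfolding subfield2_def
  by (simp add: power_mult_distrib frobenius_frobenius frobenius_double mult.commute)

lemma chi_add: "x \<in> {0, 1} \<Longrightarrow> y \<in> {0, 1} \<Longrightarrow> chi (x + y :: 'a) = chi x * chi y"
  by (auto simp: chi_def)

lemma binary_add: "x \<in> {0, 1} \<Longrightarrow> y \<in> {0, 1} \<Longrightarrow> x + y \<in> {0, 1 :: 'a}"
  by auto

lemma chi_Tr_add: "chi (Tr (x + y)) = chi (Tr x) * chi (Tr y)"
  unfolding tr_add by (rule chi_add[OF Tr_cases Tr_cases])

lemma chi_square: "chi x * chi x = 1"
  by (simp add: chi_def)

lemma chi_cases: "chi x = 1 \<or> chi x = -1"
  by (simp add: chi_def)

text \<open>Translation by an element \<open>g\<close> with \<open>f g = -1\<close> permutes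
  \<open>G\<close>, since \<open>g + g = 0\<close>, and negates the sum.\<close>

lemma sum_character:
  fixes f :: "'a \<Rightarrow> int"
  assumes closed: "\<And>x y. x \<in> G \<Longrightarrow> y \<in> G \<Longrightarrow> x + y \<in> G"
    and mult: "\<And>x y. x \<in> G \<Longrightarrow> y \<in> G \<Longrightarrow> f (x + y) = f x * f y"
    and val: "\<And>x. x \<in> G \<Longrightarrow> f x = 1 \<or> f x = -1"
  shows "sum f G = (if \<forall>x\<in>G. f x = 1 then int (card G) else 0)"
proof (cases "\<forall>x\<in>G. f x = 1")
  case False
  then obtain g where g: "g \<in> G" "f g = -1"
    using val by blast
  have "sum f G = (\<Sum>x\<in>G. f (x + g))"
    by (rule sum.reindex_bij_witness[of _ "\<lambda>x. x + g" "\<lambda>x. x + g"])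
      (auto simp: add.assoc intro: closed g)
  also have "\<dots> = - sum f G"
    using g by (simp add: mult sum_negf)
  finally show ?thesis
    using False by auto
qed simp

lemma sum_chi_Tr: "(\<Sum>x\<in>UNIV. chi (Tr (x * z))) = (if z = 0 then 2 ^ (2 * s) else 0)"
proof -
  have "(\<Sum>x\<in>UNIV. chi (Tr (x * z))) = (if \<forall>x\<in>UNIV. chi (Tr (x * z)) = 1 then int CARD('a) else 0)"
    using chi_cases by (intro sum_character) (auto simp: distrib_right chi_Tr_add)
  moreover have "\<exists>x. Tr (x * z) \<noteq> 0" if "z \<noteq> 0"
    using rel_tr_nondegenerate[of "2 * s" 1 z] that s_pos subfield2_full by (metis tr_eq_rel_tr
        dvd_refl mult_1 nat_0_less_mult_iff pos2 zero_less_one)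
  ultimately show ?thesis
    by (auto simp: card_field chi_def tr_0)
qed

lemma sum_chi_subfield:
  assumes "(z::'a) \<in> subfield2 s"
  shows "(\<Sum>a\<in>subfield2 s. chi (tr s (a * z))) = (if z = 0 then 2 ^ s else 0)"
proof -
  note cl = subfield2_closed[OF card_field]
  have bin: "tr s (a * z) \<in> {0, 1}" if "a \<in> subfield2 s" for a
    by (rule tr_in_prime_field[OF card_field cl(4)[OF that assms]])
  have "(\<Sum>a\<in>subfield2 s. chi (tr s (a * z)))
    = (if \<forall>a\<in>subfield2 s. chi (tr s (a * z)) = 1 then int (card (subfield2 s :: 'a set)) else 0)"
    by (rule sum_character) (simp_all only: cl(3) distrib_right tr_add chi_add[OF bin bin] chi_cases)
  moreover have "\<exists>a\<in>subfield2 s. tr s (a * z) \<noteq> 0" if "z \<noteq> 0"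
    by (rule rel_tr_nondegenerate[of s 1 z]) (use that s_pos assms in \<open>auto simp: tr_eq_rel_tr\<close>)
  ultimately show ?thesis
    by (auto simp: card_subfield2[OF card_field s_pos] chi_def tr_0)
qed

end

section \<open>Exponential sums of the quadratic forms\<close>

locale kasami_code = even_degree_field s F for s and F :: "'a::finite_field itself" +
  fixes l :: nat
  assumes s_ge: "s \<ge> 2" and l_pos: "1 \<le> l" and l_less: "l < 2 * s" and l_neq: "l \<noteq> s"
begin

definition Q :: "'a \<Rightarrow> 'a \<Rightarrow> 'a \<Rightarrow> 'a" where
  "Q a b x = tr s (a * x ^ (2 ^ s + 1)) + Tr (b * x ^ (2 ^ l + 1))"

text \<open>The linearised polynomial that represents the polar form of \<open>Q a b\<close> through
  the trace. The exponent \<open>2 * s - l\<close> inverts the Frobenius power \<open>l\<close>, so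
  the last summand is the adjoint of the one before it.\<close>

definition L :: "'a \<Rightarrow> 'a \<Rightarrow> 'a \<Rightarrow> 'a" where
  "L a b x = a * x ^ (2 ^ s) + b * x ^ (2 ^ l) + (b * x) ^ (2 ^ (2 * s - l))"

text \<open>This kernel is the radical of the polar form, because the trace is
  nondegenerate.\<close>

definition rad :: "'a \<Rightarrow> 'a \<Rightarrow> 'a set" where
  "rad a b = {x. L a b x = 0}"

definition T :: "'a \<Rightarrow> 'a \<Rightarrow> 'a \<Rightarrow> int" where
  "T a b c = (\<Sum>x\<in>UNIV. chi (Q a b x + Tr (c * x)))"

lemma Q_binary: "a \<in> subfield2 s \<Longrightarrow> Q a b x \<in> {0, 1}"
  unfolding Q_def
  by (intro binary_add tr_in_prime_field[OF card_field] Tr_cases subfield2_closed(4)[OF card_field]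
      norm_in_subfield2)

lemma L_add: "L a b (x + y) = L a b x + L a b y"
  by (simp add: L_def frobenius_add distrib_left add_ac)

lemma L_0: "L a b 0 = 0"
  by (simp add: L_def power_0_left)

lemma rad_closed: "0 \<in> rad a b" "x \<in> rad a b \<Longrightarrow> y \<in> rad a b \<Longrightarrow> x + y \<in> rad a b"
  by (auto simp: rad_def L_0 L_add)

lemma card_rad_pos: "card (rad a b) > 0"
  using rad_closed(1) by (auto simp: card_gt_0_iff)

lemma frobenius_adjoint: "(y * (b * x) ^ (2 ^ (2 * s - l))) ^ (2 ^ l) = b * x * (y :: 'a) ^ (2 ^ l)"
  using l_less
  by (simp add: power_mult_distrib frobenius_frobenius frobenius_full mult.commute[of "y ^ 2 ^ l"])

lemma Tr_adjoint: "Tr (y * (b * x) ^ (2 ^ (2 * s - l))) = Tr (b * x * y ^ (2 ^ l))"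
  using Tr_frobenius[of "y * (b * x) ^ (2 ^ (2 * s - l))" l] by (simp only: frobenius_adjoint)

text \<open>The two products on the left are conjugate over the subfield of order
  \<open>2 ^ s\<close>, so their sum is the relative trace of one of them, and transitivity of the
  trace applies.\<close>

lemma tr_norm_polar:
  assumes "a \<in> subfield2 s"
  shows "tr s (a * (x ^ (2 ^ s) * y + x * y ^ (2 ^ s))) = Tr (y * (a * x ^ (2 ^ s)))"
proof -
  have "a ^ (2 ^ s) = a"
    using assms by (simp add: subfield2_def)
  then show ?thesis
    unfolding Tr_eq_tr
    by (simp add: power_mult_distrib frobenius_frobenius frobenius_double algebra_simps)
qed

lemma Tr_L:
  assumes "a \<in> subfield2 s"
  shows "Tr (y * L a b x) = tr s (a * (x ^ (2 ^ s) * y + x * y ^ (2 ^ s)))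
    + Tr (b * (x ^ (2 ^ l) * y + x * y ^ (2 ^ l)))"
proof -
  have "Tr (y * L a b x) = Tr (y * (a * x ^ (2 ^ s))) + Tr (y * (b * x ^ (2 ^ l)))
      + Tr (b * x * y ^ (2 ^ l))"
    by (simp add: L_def distrib_left tr_add Tr_adjoint)
  also have "\<dots> = tr s (a * (x ^ (2 ^ s) * y + x * y ^ (2 ^ s)))
      + Tr (b * (x ^ (2 ^ l) * y + x * y ^ (2 ^ l)))"
    unfolding tr_norm_polar[OF assms] by (simp add: distrib_left tr_add mult_ac)
  finally show ?thesis .
qed

lemma Q_add:
  assumes "a \<in> subfield2 s"
  shows "Q a b (x + y) = Q a b x + Q a b y + Tr (y * L a b x)"
proof -
  have e: "c * (x + y) ^ (2 ^ k + 1) = c * x ^ (2 ^ k + 1) + c * y ^ (2 ^ k + 1)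
      + c * (x ^ (2 ^ k) * y + x * y ^ (2 ^ k))" for c k
    by (simp add: frobenius_add algebra_simps)
  show ?thesis
    unfolding Q_def e Tr_L[OF assms] by (simp add: tr_add add_ac)
qed

section \<open>Squares and value counts of the exponential sums\<close>

definition form_sign :: "'a \<Rightarrow> 'a \<Rightarrow> 'a \<Rightarrow> 'a \<Rightarrow> int" where
  "form_sign a b c x = chi (Q a b x + Tr (c * x))"

lemma form_sign_eq: "a \<in> subfield2 s \<Longrightarrow> form_sign a b c x = chi (Q a b x) * chi (Tr (c * x))"
  unfolding form_sign_def by (intro chi_add Q_binary Tr_cases)

lemma form_sign_add:
  assumes "a \<in> subfield2 s"
  shows "form_sign a b c (x + y) = form_sign a b c x * form_sign a b c y * chi (Tr (y * L a b x))"
proof -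
  have "chi (Q a b (x + y)) = chi (Q a b x) * chi (Q a b y) * chi (Tr (y * L a b x))"
    unfolding Q_add[OF assms] by (simp only: chi_add binary_add Q_binary[OF assms] Tr_cases)
  then show ?thesis
    by (simp add: form_sign_eq[OF assms] distrib_left chi_Tr_add)
qed

lemma sum_shift: "(\<Sum>y\<in>UNIV. g y) = (\<Sum>y\<in>UNIV. g (y + x :: 'a) :: int)"
  by (rule sum.reindex_bij_witness[of _ "\<lambda>y. y + x" "\<lambda>y. y + x"]) (auto simp: add.assoc)

text \<open>After substituting \<open>y + x\<close> for \<open>y\<close>, polarisation leaves a
  trace that is linear in \<open>x\<close>; orthogonality in \<open>x\<close> then keeps only the
  \<open>y\<close> in the radical.\<close>

lemma T_square_sum:
  assumes "a \<in> subfield2 s"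
  shows "(T a b c)\<^sup>2 = 2 ^ (2 * s) * (\<Sum>y\<in>rad a b. form_sign a b c y)"
proof -
  have "(T a b c)\<^sup>2 = (\<Sum>x\<in>UNIV. \<Sum>y\<in>UNIV. form_sign a b c x * form_sign a b c y)"
    by (simp add: T_def form_sign_def power2_eq_square sum_product)
  also have "\<dots> = (\<Sum>x\<in>UNIV. \<Sum>y\<in>UNIV. form_sign a b c x * form_sign a b c (y + x))"
    by (rule sum.cong[OF refl], rule sum_shift)
  also have "\<dots> = (\<Sum>x\<in>UNIV. \<Sum>y\<in>UNIV. form_sign a b c y * chi (Tr (x * L a b y)))"
  proof (intro sum.cong refl)
    fix x y
    have "form_sign a b c x * form_sign a b c (y + x) = (form_sign a b c x * form_sign a b c x) * (form_sign a b c y * chi (Tr (x * L a b y)))"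
      unfolding form_sign_add[OF assms] by (simp only: mult_ac)
    then show "form_sign a b c x * form_sign a b c (y + x) = form_sign a b c y * chi (Tr (x * L a b y))"
      by (simp add: form_sign_def chi_square)
  qed
  also have "\<dots> = (\<Sum>y\<in>UNIV. form_sign a b c y * (\<Sum>x\<in>UNIV. chi (Tr (x * L a b y))))"
    by (subst sum.swap) (simp add: sum_distrib_left)
  also have "\<dots> = (\<Sum>y\<in>UNIV. if y \<in> rad a b then form_sign a b c y * 2 ^ (2 * s) else 0)"
    unfolding sum_chi_Tr rad_def by (intro sum.cong refl) auto
  also have "\<dots> = 2 ^ (2 * s) * (\<Sum>y\<in>rad a b. form_sign a b c y)"
    by (simp add: sum.If_cases sum_distrib_left mult.commute)
  finally show ?thesis .
qed

text \<open>On the radical the polar form vanishes, so \<open>form_sign\<close> is a character there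
  and its sum is zero or the size of the radical.\<close>

lemma T_square:
  assumes "a \<in> subfield2 s"
  shows "T a b c = 0 \<or> (T a b c)\<^sup>2 = 2 ^ (2 * s) * int (card (rad a b))"
proof -
  have "(\<Sum>y\<in>rad a b. form_sign a b c y)
    = (if \<forall>y\<in>rad a b. form_sign a b c y = 1 then int (card (rad a b)) else 0)"
  proof (rule sum_character)
    fix x y assume "x \<in> rad a b" "y \<in> rad a b"
    then show "form_sign a b c (x + y) = form_sign a b c x * form_sign a b c y"
      by (simp add: form_sign_add[OF assms] rad_def tr_0 chi_def[of 0])
  qed (auto simp: rad_closed form_sign_def chi_cases)
  then show ?thesis
    using T_square_sum[OF assms, of b c] by (auto split: if_splits)
qed

text \<open>Parseval: orthogonality in \<open>c\<close> keeps only the diagonal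
  \<open>x = y\<close>, where the signs square to 1.\<close>

lemma sum_T_square:
  assumes "a \<in> subfield2 s"
  shows "(\<Sum>c\<in>UNIV. (T a b c)\<^sup>2) = 2 ^ (2 * s) * 2 ^ (2 * s)"
proof -
  have "(\<Sum>c\<in>UNIV. (T a b c)\<^sup>2) = (\<Sum>c\<in>UNIV. \<Sum>x\<in>UNIV. \<Sum>y\<in>UNIV.
      chi (Q a b x) * chi (Q a b y) * chi (Tr (c * (x + y))))"
    by (simp add: T_def[folded form_sign_def] form_sign_eq[OF assms] power2_eq_square sum_product distrib_left
        chi_Tr_add) (simp add: mult_ac)
  also have "\<dots> = (\<Sum>x\<in>UNIV. \<Sum>y\<in>UNIV. \<Sum>c\<in>UNIV.
      chi (Q a b x) * chi (Q a b y) * chi (Tr (c * (x + y))))"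
    by (rule trans[OF sum.swap], rule sum.cong[OF refl], rule sum.swap)
  also have "\<dots> = (\<Sum>x\<in>UNIV. \<Sum>y\<in>UNIV. chi (Q a b x) * chi (Q a b y) * (if x = y then 2 ^ (2 * s) else 0))"
    unfolding sum_distrib_left[symmetric] sum_chi_Tr add_eq_0_iff_eq ..
  also have "\<dots> = (\<Sum>x\<in>(UNIV::'a set). 2 ^ (2 * s))"
    by (simp add: chi_square if_distrib[of "\<lambda>u. _ * u"] cong: if_cong)
  finally show ?thesis
    by (simp add: card_field)
qed

text \<open>All nonzero squares of \<open>T a b c\<close> are the same number, so the Parseval sum
  counts them.\<close>

lemma card_T_nonzero:
  assumes "a \<in> subfield2 s"
  shows "card {c. T a b c \<noteq> 0} * card (rad a b) = 2 ^ (2 * s)"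
proof -
  have "(\<Sum>c\<in>UNIV. (T a b c)\<^sup>2)
      = (\<Sum>c\<in>UNIV. if T a b c \<noteq> 0 then 2 ^ (2 * s) * int (card (rad a b)) else 0)"
    using T_square[OF assms] by (intro sum.cong refl) auto
  also have "\<dots> = int (card {c. T a b c \<noteq> 0}) * (2 ^ (2 * s) * int (card (rad a b)))"
    by (simp add: sum.If_cases)
  finally have "2 ^ (2 * s) * int (card {c. T a b c \<noteq> 0} * card (rad a b))
      = 2 ^ (2 * s) * int (2 ^ (2 * s))"
    by (simp add: sum_T_square[OF assms])
  then show ?thesis
    by (metis mult_left_cancel of_nat_eq_iff power_not_zero zero_neq_numeral)
qed

text \<open>If \<open>T a b c\<close> is nonzero, exactly one of the two values of \<open>h\<close>
  produces a prescribed sign; if it is zero, both values count. So the signs of the sums need not be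
  known.\<close>

lemma card_signed_T:
  assumes "a \<in> subfield2 s"
  shows "real (card {(c, h :: 'a). h \<in> {0, 1} \<and> chi h * T a b c = v}) =
    (if v = 0 then 2 * (2 ^ (2 * s) - 2 ^ (2 * s) / real (card (rad a b)))
     else if v\<^sup>2 = 2 ^ (2 * s) * int (card (rad a b)) then 2 ^ (2 * s) / real (card (rad a b))
     else 0)"
    (is "real (card ?S) = _")
proof -
  let ?N = "{c. T a b c \<noteq> 0}"
  have "real (card ?N * card (rad a b)) = 2 ^ (2 * s)"
    by (simp only: card_T_nonzero[OF assms]) simp
  moreover have "real (card (rad a b)) \<noteq> 0"
    using card_rad_pos[of a b] by linarith
  ultimately have N: "real (card ?N) = 2 ^ (2 * s) / real (card (rad a b))"
    by (simp only: nonzero_eq_divide_eq of_nat_mult not_False_eq_True)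
  consider "v = 0" | "v \<noteq> 0" "v\<^sup>2 = 2 ^ (2 * s) * int (card (rad a b))"
    | "v \<noteq> 0" "v\<^sup>2 \<noteq> 2 ^ (2 * s) * int (card (rad a b))"
    by blast
  then show ?thesis
  proof cases
    case 1
    then have "?S = (UNIV - ?N) \<times> {0, 1}"
      using chi_cases by (auto simp: chi_def)
    then have "card ?S = 2 * (CARD('a) - card ?N)"
      by (simp add: card_cartesian_product card_Diff_subset)
    moreover have "card ?N \<le> CARD('a)"
      by (rule card_mono) auto
    ultimately show ?thesis
      using 1 N by (simp add: card_field of_nat_diff)
  next
    case 2
    have sq: "- T a b c = v" if "T a b c \<noteq> 0" "T a b c \<noteq> v" for c
      using T_square[OF assms, of b c] that 2 power2_eq_iff[of "T a b c" v] by auto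
    have "?S = (\<lambda>c. (c, if T a b c = v then 0 else 1)) ` ?N"
      using sq 2 by (auto simp: chi_def image_iff split: if_splits)
    then have "card ?S = card ?N"
      by (simp add: card_image inj_on_def)
    then show ?thesis
      using 2 N by simp
  next
    case 3
    have "chi h * T a b c \<noteq> v" for c h :: 'a
      using chi_cases[of h] 3 T_square[OF assms, of b c] by auto
    then have "?S = {}"
      by auto
    then show ?thesis
      using 3 by (simp only: card.empty) simp
  qed
qed

end

section \<open>Radicals\<close>

context even_degree_field
begin

text \<open>Every nonempty fibre of an additive map is a translate of its kernel.\<close>

lemma card_kernel_image:
  fixes \<phi> :: "'a \<Rightarrow> 'a"
  assumes closed: "\<And>x y. x \<in> G \<Longrightarrow> y \<in> G \<Longrightarrow> x + y \<in> G"
    and add: "\<And>x y. x \<in> G \<Longrightarrow> y \<in> G \<Longrightarrow> \<phi> (x + y) = \<phi> x + \<phi> y"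
  shows "card G = card {x \<in> G. \<phi> x = 0} * card (\<phi> ` G)"
proof -
  have "card {x \<in> G. \<phi> x = y} = card {x \<in> G. \<phi> x = 0}" if "y \<in> \<phi> ` G" for y
  proof -
    from that obtain z where z: "z \<in> G" "\<phi> z = y"
      by auto
    have "bij_betw (\<lambda>x. x + z) {x \<in> G. \<phi> x = y} {x \<in> G. \<phi> x = 0}"
      by (rule bij_betwI[where g = "\<lambda>x. x + z"]) (auto simp: z add closed add.assoc)
    then show ?thesis
      by (rule bij_betw_same_card)
  qed
  then have "(\<Sum>y\<in>\<phi> ` G. card {x \<in> G. \<phi> x = y}) = (\<Sum>y\<in>\<phi> ` G. card {x \<in> G. \<phi> x = 0})"
    by (rule sum.cong[OF refl])
  moreover have "card G = (\<Sum>y\<in>\<phi> ` G. card {x \<in> G. \<phi> x = y})"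
    using sum.image_gen[of G "\<lambda>_. 1 :: nat" \<phi>] by simp
  ultimately show ?thesis
    by simp
qed

lemma card_scaled:
  "(x::'a) \<noteq> 0 \<Longrightarrow> card ((\<lambda>u. u * x) ` K) = card K"
  by (simp add: card_image inj_on_def)

lemma in_scaled: "(x::'a) \<noteq> 0 \<Longrightarrow> y \<in> (\<lambda>u. u * x) ` K \<longleftrightarrow> y / x \<in> K"
  using rev_image_eqI[of "y / x" K y "\<lambda>u. u * x"] by auto

text \<open>Substituting \<open>y = x0 * z\<close> for a nonzero solution \<open>x0\<close> turns the equation into one of degree
  one in the Frobenius power for \<open>z ^ (2 ^ e) + z\<close>.\<close>

lemma card_frobenius_quadratic_kernel:
  fixes A B C :: 'a and e :: nat
  assumes "A \<noteq> 0"
  defines "K \<equiv> subfield2 e :: 'a set"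
  defines "V \<equiv> {x. A * x ^ (2 ^ (e + e)) + B * x ^ (2 ^ e) + C * x = 0}"
  shows "card V \<in> {1, card K, (card K)\<^sup>2}"
proof (cases "V = {0}")
  case False
  have V0: "0 \<in> V"
    by (simp add: V_def power_0_left)
  have Vadd: "x + y \<in> V" if "x \<in> V" "y \<in> V" for x y
  proof -
    have "A * (x + y) ^ (2 ^ (e + e)) + B * (x + y) ^ (2 ^ e) + C * (x + y)
      = (A * x ^ (2 ^ (e + e)) + B * x ^ (2 ^ e) + C * x)
        + (A * y ^ (2 ^ (e + e)) + B * y ^ (2 ^ e) + C * y)"
      unfolding frobenius_add by (simp add: algebra_simps)
    then show ?thesis
      using that by (simp add: V_def)
  qed
  have K_frob: "u ^ (2 ^ e) = u" "u ^ (2 ^ (e + e)) = u" if "u \<in> K" for u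
    using that by (simp_all add: K_def subfield2_def flip: frobenius_frobenius)
  have Vscale: "u * x \<in> V" if "u \<in> K" "x \<in> V" for u x
  proof -
    have "A * (u * x) ^ (2 ^ (e + e)) + B * (u * x) ^ (2 ^ e) + C * (u * x)
      = u * (A * x ^ (2 ^ (e + e)) + B * x ^ (2 ^ e) + C * x)"
      unfolding power_mult_distrib K_frob[OF that(1)] by (simp add: algebra_simps)
    then show ?thesis
      using that by (simp add: V_def)
  qed
  obtain x0 where x0: "x0 \<in> V" "x0 \<noteq> 0"
    using False V0 by auto
  define \<phi> where "\<phi> y = (y / x0) ^ (2 ^ e) + y / x0" for y
  define A' where "A' = A * x0 ^ (2 ^ (e + e))"
  define C' where "C' = C * x0"
  have "A' \<noteq> 0"
    using assms x0 by (simp add: A'_def)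
  have "B * x0 ^ (2 ^ e) + (A' + C') = 0"
    using x0(1) by (simp add: V_def A'_def C'_def add_ac)
  \<comment> \<open>The equation for \<open>x0\<close>, arranged so that substituting
    \<open>y = x0 * z\<close> gives the coefficients \<open>A'\<close>, \<open>A' + C'\<close> and
    \<open>C'\<close>.\<close>
  then have B': "B * x0 ^ (2 ^ e) = A' + C'"
    by (simp add: add_eq_0_iff_eq)
  \<comment> \<open>With these coefficients the quadratic expression in \<open>z\<close> equals the
    linear one in \<open>w = z ^ (2 ^ e) + z\<close>.\<close>
  have W: "A' * w ^ (2 ^ e) = C' * w" if "w \<in> \<phi> ` V" for w
  proof -
    from that obtain y where y: "y \<in> V" "w = \<phi> y"
      by auto
    define z where "z = y / x0"
    have yz: "y = x0 * z"
      using x0 by (simp add: z_def)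
    have w: "w = z ^ (2 ^ e) + z"
      by (simp add: y \<phi>_def z_def)
    have "A' * w ^ (2 ^ e) + C' * w = A' * z ^ (2 ^ (e + e)) + (A' + C') * z ^ (2 ^ e) + C' * z"
      by (simp add: w frobenius_add frobenius_frobenius algebra_simps)
    also have "\<dots> = A * y ^ (2 ^ (e + e)) + B * y ^ (2 ^ e) + C * y"
      unfolding B'[symmetric] unfolding A'_def C'_def yz by (simp add: power_mult_distrib mult.assoc)
    also have "\<dots> = 0"
      using y by (simp add: V_def)
    finally show ?thesis
      by (simp add: add_eq_0_iff_eq)
  qed
  have W0: "0 \<in> \<phi> ` V"
    by (rule image_eqI[of _ _ 0]) (simp_all add: V0 \<phi>_def power_0_left)
  have Wscale: "u * w \<in> \<phi> ` V" if "u \<in> K" "w \<in> \<phi> ` V" for u w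
  proof -
    from that obtain y where y: "y \<in> V" "w = \<phi> y"
      by auto
    have "u * w = \<phi> (u * y)"
      unfolding y \<phi>_def times_divide_eq_right[symmetric] power_mult_distrib K_frob[OF that(1)]
      by (simp add: algebra_simps)
    then show ?thesis
      using Vscale[OF that(1) y(1)] by simp
  qed
  \<comment> \<open>Two nonzero solutions of the linear equation have a ratio in \<open>K\<close>,
    so the image is zero or a line over \<open>K\<close>.\<close>
  have "card (\<phi> ` V) \<in> {1, card K}"
  proof (cases "\<phi> ` V = {0}")
    case False
    then obtain w0 where w0: "w0 \<in> \<phi> ` V" "w0 \<noteq> 0"
      using W0 by auto
    have "w \<in> (\<lambda>u. u * w0) ` K" if "w \<in> \<phi> ` V" for w
    proof -
      have "A' * (w ^ (2 ^ e) * w0) = C' * w * w0"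
        using W[OF that] by (simp flip: mult.assoc)
      also have "\<dots> = A' * (w * w0 ^ (2 ^ e))"
        using W[OF w0(1)] by (metis mult.assoc mult.commute)
      finally have "w ^ (2 ^ e) * w0 = w * w0 ^ (2 ^ e)"
        using \<open>A' \<noteq> 0\<close> by simp
      then have "w / w0 \<in> K"
        using w0 by (simp add: K_def subfield2_def power_divide frac_eq_eq)
      then show ?thesis
        using in_scaled[OF w0(2)] by blast
    qed
    moreover have "(\<lambda>u. u * w0) ` K \<subseteq> \<phi> ` V"
      using Wscale w0 by auto
    ultimately have "\<phi> ` V = (\<lambda>u. u * w0) ` K"
      by auto
    then show ?thesis
      using card_scaled[OF w0(2)] by simp
  qed simp
  moreover have "card V = card {x \<in> V. \<phi> x = 0} * card (\<phi> ` V)"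
    by (rule card_kernel_image)
      (auto simp: Vadd \<phi>_def add_divide_distrib frobenius_add add_ac)
  moreover have "{x \<in> V. \<phi> x = 0} = (\<lambda>u. u * x0) ` K"
  proof (rule Set.set_eqI)
    fix x
    have "\<phi> x = 0 \<longleftrightarrow> x / x0 \<in> K"
      by (simp add: \<phi>_def K_def subfield2_def add_eq_0_iff_eq)
    moreover have "x \<in> V" if "x / x0 \<in> K"
      using Vscale[OF that x0(1)] x0(2) by simp
    ultimately show "x \<in> {x \<in> V. \<phi> x = 0} \<longleftrightarrow> x \<in> (\<lambda>u. u * x0) ` K"
      using in_scaled[OF x0(2)] by blast
  qed
  ultimately show ?thesis
    using card_scaled[OF x0(2)] by (auto simp: power2_eq_square)
qed simp

lemma card_subfield2_gcd:
  assumes "e > 0"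
  shows "card (subfield2 e :: 'a set) = 2 ^ gcd e (2 * s)"
proof -
  have "(subfield2 e :: 'a set) = subfield2 (gcd e (2 * s))"
  proof (rule Set.set_eqI)
    fix x :: 'a
    show "x \<in> subfield2 e \<longleftrightarrow> x \<in> subfield2 (gcd e (2 * s))"
      using subfield2_dvd[of x "gcd e (2 * s)" e] subfield2_gcd[of x e "2 * s"]
        subfield2_full[of "2 * s" x] gcd_dvd1[of e "2 * s"] by argo
  qed
  then show ?thesis
    using card_subfield2_dvd[OF card_field, of "gcd e (2 * s)"] assms by simp
qed

end

context kasami_code
begin

text \<open>Raising to the power \<open>2 ^ l\<close> preserves zeros and removes the inverse
  Frobenius power. Since \<open>x ^ (2 ^ (2 * s)) = x\<close>, the exponent \<open>l + l\<close> may
  be replaced by \<open>(s + l) + (s + l)\<close>, so only powers of \<open>\<theta>\<close>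
  occur.\<close>

lemma rad_eq:
  "rad a b = {x. b ^ (2 ^ l) * x ^ (2 ^ ((s + l) + (s + l))) + a ^ (2 ^ l) * x ^ (2 ^ (s + l)) + b * x = 0}"
proof -
  have "L a b x ^ (2 ^ l) = b ^ (2 ^ l) * x ^ (2 ^ ((s + l) + (s + l))) + a ^ (2 ^ l) * x ^ (2 ^ (s + l)) + b * x"
    for x
  proof -
    have "x ^ (2 ^ ((s + l) + (s + l))) = x ^ (2 ^ (l + l))"
      using frobenius_full_add[of x "l + l"] by (simp add: mult_2 add_ac)
    moreover have "((b * x) ^ (2 ^ (2 * s - l))) ^ (2 ^ l) = b * x"
      using l_less by (simp add: frobenius_frobenius frobenius_full)
    ultimately show ?thesis
      unfolding L_def frobenius_add by (simp add: power_mult_distrib frobenius_frobenius add_ac)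
  qed
  from this[symmetric] show ?thesis
    by (simp only: rad_def power_eq_0_iff) simp
qed

text \<open>For \<open>b\<close> nonzero the quadratic equation in \<open>\<theta>\<close> has a
  nonzero leading coefficient, and the fixed field of \<open>\<theta>\<close> has
  \<open>2 ^ d'\<close> elements. For \<open>b = 0\<close> a single term remains.\<close>

lemma card_rad:
  assumes "(a, b) \<noteq> (0, 0)"
  defines "d' \<equiv> gcd (s + l) (2 * s)"
  shows "card (rad a b) \<in> {1, 2 ^ d', 2 ^ (2 * d')}"
proof (cases "b = 0")
  case True
  then have "rad a b = {0}"
    using assms by (auto simp: rad_eq power_0_left)
  then show ?thesis by simp
next
  case False
  then show ?thesis
    using card_frobenius_quadratic_kernel[of "b ^ (2 ^ l)" "s + l" "a ^ (2 ^ l)" b] s_pos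
    unfolding rad_eq d'_def
    by (simp add: card_subfield2_gcd power_even_eq[of "2::nat" "gcd (s + l) (2 * s)"])
qed

lemma rad_0: "rad 0 0 = UNIV"
  by (simp add: rad_def L_def power_0_left)

text \<open>Division by \<open>x\<close> places \<open>y / x\<close> in both
  \<open>subfield2 s\<close> and \<open>subfield2 l\<close>. The two equations say that the
  coefficients of \<open>a\<close> and of \<open>b\<close> in \<open>Tr (y * L a b x)\<close>
  vanish.\<close>

lemma card_orthogonal:
  assumes "(x :: 'a) \<noteq> 0"
  shows "card {y. x ^ (2 ^ s) * y + x * y ^ (2 ^ s) = 0 \<and> x ^ (2 ^ l) * y + x * y ^ (2 ^ l) = 0}
    = 2 ^ gcd s l" (is "card ?Y = _")
proof -
  have polar: "x ^ (2 ^ k) * y + x * y ^ (2 ^ k) = 0 \<longleftrightarrow> y / x \<in> subfield2 k" for y k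
  proof -
    have "x ^ (2 ^ k) * y + x * y ^ (2 ^ k) = 0 \<longleftrightarrow> y ^ (2 ^ k) * x = y * x ^ (2 ^ k)"
      unfolding add_eq_0_iff_eq by (auto simp: mult.commute)
    also have "\<dots> \<longleftrightarrow> y / x \<in> subfield2 k"
      using assms by (simp add: subfield2_def power_divide frac_eq_eq)
    finally show ?thesis .
  qed
  have "?Y = (\<lambda>u. u * x) ` subfield2 (gcd s l)"
  proof (rule Set.set_eqI)
    fix y
    have "y \<in> ?Y \<longleftrightarrow> y / x \<in> subfield2 s \<and> y / x \<in> subfield2 l"
      by (simp add: polar)
    also have "\<dots> \<longleftrightarrow> y / x \<in> subfield2 (gcd s l)"
      by (meson subfield2_gcd subfield2_dvd gcd_dvd1 gcd_dvd2)
    also have "\<dots> \<longleftrightarrow> y \<in> (\<lambda>u. u * x) ` subfield2 (gcd s l)"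
      by (rule in_scaled[OF assms, symmetric])
    finally show "y \<in> ?Y \<longleftrightarrow> y \<in> (\<lambda>u. u * x) ` subfield2 (gcd s l)" .
  qed
  moreover have "card (subfield2 (gcd s l) :: 'a set) = 2 ^ gcd s l"
    using s_pos by (intro card_subfield2_dvd[OF card_field]) auto
  ultimately show ?thesis
    using card_scaled[OF assms] by simp
qed

lemma polar_in_subfield2: "(x :: 'a) ^ (2 ^ s) * y + x * y ^ (2 ^ s) \<in> subfield2 s"
  by (simp add: subfield2_def frobenius_add power_mult_distrib frobenius_frobenius frobenius_double
      add.commute)

text \<open>A sum of signs over \<open>y\<close> detects \<open>L a b x = 0\<close>. The sign splits
  into a factor for \<open>a\<close> and one for \<open>b\<close>, so after exchanging the sums,
  orthogonality leaves the \<open>y\<close> counted by \<open>card_orthogonal\<close>.\<close>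

lemma card_forms_with_radical_element:
  assumes "x \<noteq> 0"
  shows "card {(a, b). a \<in> subfield2 s \<and> x \<in> rad a b} = 2 ^ (s + gcd s l)"
proof -
  let ?P = "(subfield2 s :: 'a set) \<times> (UNIV :: 'a set)"
  define p where "p k y = x ^ (2 ^ k) * y + x * y ^ (2 ^ k)" for k y
  have split: "chi (Tr (y * L a b x)) = chi (tr s (a * p s y)) * chi (Tr (b * p l y))"
    if "a \<in> subfield2 s" for a b y
    unfolding Tr_L[OF that] p_def
    by (intro chi_add Tr_cases tr_in_prime_field[OF card_field] subfield2_closed(4)[OF card_field]
        polar_in_subfield2 that)
  have "int (card {(a, b). a \<in> subfield2 s \<and> x \<in> rad a b}) * 2 ^ (2 * s)
      = (\<Sum>(a,b)\<in>?P. if L a b x = 0 then 2 ^ (2 * s) else 0)"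
  proof -
    have "?P \<inter> {p. L (fst p) (snd p) x = 0} = {(a, b). a \<in> subfield2 s \<and> x \<in> rad a b}"
      by (auto simp: rad_def)
    then show ?thesis
      by (simp add: case_prod_unfold sum.If_cases)
  qed
  also have "\<dots> = (\<Sum>(a,b)\<in>?P. \<Sum>y\<in>UNIV. chi (Tr (y * L a b x)))"
    by (simp add: sum_chi_Tr)
  also have "\<dots> = (\<Sum>(a,b)\<in>?P. \<Sum>y\<in>UNIV. chi (tr s (a * p s y)) * chi (Tr (b * p l y)))"
    by (intro sum.cong refl) (auto simp: split)
  also have "\<dots> = (\<Sum>y\<in>UNIV. \<Sum>(a,b)\<in>?P. chi (tr s (a * p s y)) * chi (Tr (b * p l y)))"
    unfolding case_prod_unfold by (rule sum.swap)
  also have "\<dots> = (\<Sum>y\<in>UNIV. (\<Sum>a\<in>subfield2 s. chi (tr s (a * p s y))) * (\<Sum>b\<in>UNIV. chi (Tr (b * p l y))))"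
    by (simp add: sum_product sum.cartesian_product)
  also have "\<dots> = (\<Sum>y\<in>UNIV. if p s y = 0 \<and> p l y = 0 then 2 ^ s * 2 ^ (2 * s) else 0)"
    by (intro sum.cong refl) (simp add: sum_chi_Tr sum_chi_subfield p_def polar_in_subfield2)
  also have "\<dots> = 2 ^ gcd s l * (2 ^ s * 2 ^ (2 * s))"
    using card_orthogonal[OF assms] by (simp add: sum.If_cases p_def)
  finally have "int (card {(a, b). a \<in> subfield2 s \<and> x \<in> rad a b}) * 2 ^ (2 * s)
      = int (2 ^ (s + gcd s l)) * 2 ^ (2 * s)"
    by (simp add: power_add)
  then show ?thesis
    by (simp only: mult_cancel_right of_nat_eq_iff power_eq_0_iff) simp
qed

text \<open>Pairs of a form and a radical element are counted by the element: 0 lies in all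
  \<open>2 ^ (3 * s)\<close> radicals, and every other element in equally many.\<close>

lemma sum_card_rad:
  "(\<Sum>(a,b)\<in>subfield2 s \<times> UNIV. card (rad a b))
    = 2 ^ (3 * s) + (2 ^ (2 * s) - 1) * 2 ^ (s + gcd s l)"
proof -
  let ?P = "(subfield2 s :: 'a set) \<times> (UNIV :: 'a set)"
  have "card (rad a b) = (\<Sum>x\<in>UNIV. if x \<in> rad a b then 1 else 0)" for a b
    by (simp add: sum.If_cases)
  then have "(\<Sum>(a,b)\<in>?P. card (rad a b)) = (\<Sum>(a,b)\<in>?P. \<Sum>x\<in>UNIV. if x \<in> rad a b then 1 else 0)"
    by simp
  also have "\<dots> = (\<Sum>x\<in>UNIV. \<Sum>(a,b)\<in>?P. if x \<in> rad a b then 1 else 0)"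
    unfolding case_prod_unfold by (rule sum.swap)
  also have "\<dots> = (\<Sum>x\<in>UNIV. card {(a, b). a \<in> subfield2 s \<and> x \<in> rad a b})"
  proof (rule sum.cong[OF refl])
    fix x
    have "?P \<inter> {p. x \<in> rad (fst p) (snd p)} = {(a, b). a \<in> subfield2 s \<and> x \<in> rad a b}"
      by auto
    then show "(\<Sum>(a,b)\<in>?P. if x \<in> rad a b then 1 else 0) = card {(a, b). a \<in> subfield2 s \<and> x \<in> rad a b}"
      by (simp add: case_prod_unfold sum.If_cases)
  qed
  also have "\<dots> = card {(a, b). a \<in> subfield2 s \<and> 0 \<in> rad a b} + (\<Sum>x\<in>UNIV - {0 :: 'a}. 2 ^ (s + gcd s l))"
    by (subst sum.remove[of _ 0]) (simp_all add: card_forms_with_radical_element)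
  also have "{(a, b). a \<in> subfield2 s \<and> 0 \<in> rad a b} = ?P"
    by (auto simp: rad_closed)
  also have "card ?P = 2 ^ (3 * s)"
    by (simp add: card_cartesian_product card_subfield2[OF card_field s_pos] card_field
        flip: power_add)
  finally show ?thesis
    by (simp add: card_Diff_singleton card_field)
qed

text \<open>When \<open>a\<close> and \<open>b\<close> are summed first, orthogonality leaves only
  \<open>x = 0\<close>, since \<open>x ^ (2 ^ l + 1)\<close> is nonzero for all other
  \<open>x\<close>.\<close>

lemma sum_T: "(\<Sum>(a,b)\<in>subfield2 s \<times> UNIV. T a b 0) = 2 ^ (3 * s)"
proof -
  let ?P = "(subfield2 s :: 'a set) \<times> (UNIV :: 'a set)"
  have split: "chi (Q a b x) = chi (tr s (a * x ^ (2 ^ s + 1))) * chi (Tr (b * x ^ (2 ^ l + 1)))"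
    if "a \<in> subfield2 s" for a b x
    unfolding Q_def
    by (intro chi_add Tr_cases tr_in_prime_field[OF card_field] subfield2_closed(4)[OF card_field]
        norm_in_subfield2 that)
  have "(\<Sum>(a,b)\<in>?P. T a b 0)
      = (\<Sum>(a,b)\<in>?P. \<Sum>x\<in>UNIV. chi (tr s (a * x ^ (2 ^ s + 1))) * chi (Tr (b * x ^ (2 ^ l + 1))))"
    by (intro sum.cong refl) (auto simp: T_def split tr_0)
  also have "\<dots> = (\<Sum>x\<in>UNIV. \<Sum>(a,b)\<in>?P. chi (tr s (a * x ^ (2 ^ s + 1))) * chi (Tr (b * x ^ (2 ^ l + 1))))"
    unfolding case_prod_unfold by (rule sum.swap)
  also have "\<dots> = (\<Sum>x\<in>UNIV. (\<Sum>a\<in>subfield2 s. chi (tr s (a * x ^ (2 ^ s + 1))))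
      * (\<Sum>b\<in>UNIV. chi (Tr (b * x ^ (2 ^ l + 1)))))"
    by (simp add: sum_product sum.cartesian_product)
  also have "\<dots> = (\<Sum>x\<in>(UNIV :: 'a set). if x = 0 then 2 ^ s * 2 ^ (2 * s) else 0)"
    unfolding sum_chi_Tr by (intro sum.cong refl) (simp add: tr_0 chi_def card_subfield2[OF card_field s_pos])
  finally show ?thesis
    by (simp flip: power_add)
qed

end

section \<open>The two cases for the radical\<close>

lemma odd_power_plus_one_dvd:
  assumes "odd k"
  shows "2 ^ d + 1 dvd (2 ^ (d * k) + 1 :: nat)"
proof -
  have "[2 ^ d = - 1] (mod (2 ^ d + 1 :: int))"
    by (simp add: cong_iff_dvd_diff)
  then have "[(2 ^ d) ^ k = (- 1) ^ k] (mod (2 ^ d + 1 :: int))"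
    by (rule cong_pow)
  then have "(2 ^ d + 1 :: int) dvd 2 ^ (d * k) + 1"
    using assms by (simp add: cong_iff_dvd_diff flip: power_mult)
  then have "int (2 ^ d + 1) dvd int (2 ^ (d * k) + 1)"
    by (simp add: add.commute)
  then show ?thesis
    by (simp only: int_dvd_int_iff)
qed

text \<open>Since \<open>- D\<close> is 1 modulo \<open>D + 1\<close>, so is
  \<open>(- D) ^ e\<close>. The opposite sign would make \<open>D + 1\<close> divide 2, and
  \<open>t = 0\<close> would make it divide 1.\<close>

lemma eq_power_of_cong_one:
  fixes t D :: int
  assumes sq: "t\<^sup>2 = D ^ (2 * e) \<or> t = 0" and D: "D \<ge> 2" and cong: "D + 1 dvd t - 1"
  shows "t = (- D) ^ e"
proof -
  have "[- D = 1] (mod (D + 1))"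
    by (simp add: cong_iff_dvd_diff dvd_minus_iff[of _ "- D - 1", symmetric] add.commute)
  then have "[(- D) ^ e = 1 ^ e] (mod (D + 1))"
    by (rule cong_pow)
  then have pow: "D + 1 dvd (- D) ^ e - 1"
    by (simp add: cong_iff_dvd_diff)
  have "t \<noteq> 0"
    using cong D zdvd_imp_le[of "D + 1" 1] by auto
  then have "t\<^sup>2 = ((- D) ^ e)\<^sup>2"
    using sq by (simp add: power_minus[of D] power_mult_distrib flip: power_mult)
      (simp add: mult.commute)
  then consider "t = (- D) ^ e" | "t = - ((- D) ^ e)"
    by (auto simp: power2_eq_iff)
  then show ?thesis
  proof cases
    case 2
    have "D + 1 dvd - ((t - 1) + ((- D) ^ e - 1))"
      using cong pow by (intro dvd_minus_iff[THEN iffD2] dvd_add)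
    also have "- ((t - 1) + ((- D) ^ e - 1)) = 2"
      using 2 by simp
    finally show ?thesis
      using D zdvd_imp_le[of "D + 1" 2] by simp
  qed
qed

lemma sum_by_value:
  fixes g :: "'b \<Rightarrow> real"
  assumes "finite S" "finite V" "\<And>p. p \<in> S \<Longrightarrow> r p \<in> V"
  shows "(\<Sum>p\<in>S. g (r p)) = (\<Sum>v\<in>V. real (card {p \<in> S. r p = v}) * g v)"
proof -
  have "(\<Sum>p\<in>S. g (r p)) = (\<Sum>v\<in>V. \<Sum>p\<in>{p \<in> S. r p = v}. g (r p))"
    using assms by (subst sum.group) auto
  also have "\<dots> = (\<Sum>v\<in>V. real (card {p \<in> S. r p = v}) * g v)"
    by (intro sum.cong refl) simp
  finally show ?thesis .
qed

context even_degree_field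
begin

text \<open>Splitting off a hyperbolic plane divides the cardinality by \<open>(card K)\<^sup>2\<close> and leaves
  the radical unchanged.\<close>

lemma card_alternating_form:
  fixes B :: "'a \<Rightarrow> 'a \<Rightarrow> 'a" and V :: "'a set" and k :: nat
  defines "K \<equiv> subfield2 k :: 'a set"
  assumes in_K: "\<And>x y. B x y \<in> K"
    and add_left: "\<And>x y z. B (x + y) z = B x z + B y z"
    and add_right: "\<And>x y z. B x (y + z) = B x y + B x z"
    and scale: "\<And>u x y. u \<in> K \<Longrightarrow> B x (u * y) = u * B x y"
    and alternating: "\<And>x. B x x = 0"
    and V_add: "\<And>x y. x \<in> V \<Longrightarrow> y \<in> V \<Longrightarrow> x + y \<in> V"
    and V_scale: "\<And>u x. u \<in> K \<Longrightarrow> x \<in> V \<Longrightarrow> u * x \<in> V"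
  shows "\<exists>j. card V = card {x \<in> V. \<forall>y\<in>V. B x y = 0} * card K ^ (2 * j)"
  using V_add V_scale
proof (induction "card V" arbitrary: V rule: less_induct)
  case less
  have sym: "B x y = B y x" for x y
  proof -
    have "B x x + B x y + (B y x + B y y) = B (x + y) (x + y)"
      by (simp only: add_left add_right add_ac)
    then show ?thesis
      by (simp add: alternating add_eq_0_iff_eq)
  qed
  show ?case
  proof (cases "\<forall>x\<in>V. \<forall>y\<in>V. B x y = 0")
    case True
    then have "{x \<in> V. \<forall>y\<in>V. B x y = 0} = V" by auto
    then show ?thesis
      by (intro exI[of _ 0]) simp
  next
    case False
    then obtain x y where xy: "x \<in> V" "y \<in> V" "B x y \<noteq> 0" by auto
    \<comment> \<open>\<open>x\<close> and \<open>y\<close> span a hyperbolic plane;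
      \<open>W\<close> is its orthogonal complement in \<open>V\<close>, and \<open>g\<close>
      assembles a vector of \<open>V\<close> from its components.\<close>
    define c where "c = B x y"
    define W where "W = {z \<in> V. B x z = 0 \<and> B y z = 0}"
    define g where "g = (\<lambda>(w, u, v). w + u * x + v * y)"
    have c: "B x y = c" "B y x = c" "c \<noteq> 0"
      using xy sym by (simp_all add: c_def)
    have inv_c: "u / c \<in> K" if "u \<in> K" for u
      using that in_K subfield2_closed(4,6)[OF card_field] unfolding K_def c_def divide_inverse by blast
    have Bx: "B x (g (w, u, v)) = B x w + v * c" and By: "B y (g (w, u, v)) = B y w + u * c"
      if "u \<in> K" "v \<in> K" for w u v
      using that by (simp_all add: g_def add_right scale alternating c)
    have "bij_betw g (W \<times> K \<times> K) V"
      unfolding bij_betw_def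
    proof
      show "inj_on g (W \<times> K \<times> K)"
      proof (rule inj_onI, clarsimp)
        fix w u v w' u' v'
        assume *: "w \<in> W" "u \<in> K" "v \<in> K" "w' \<in> W" "u' \<in> K" "v' \<in> K"
          and eq: "g (w, u, v) = g (w', u', v')"
        have "v * c = v' * c" "u * c = u' * c"
          using arg_cong[OF eq, of "B x"] arg_cong[OF eq, of "B y"] * by (simp_all add: Bx By W_def)
        then have "v = v'" "u = u'"
          using c by auto
        with eq show "w = w' \<and> u = u' \<and> v = v'"
          by (simp add: g_def)
      qed
      show "g ` (W \<times> K \<times> K) = V"
      proof
        show "g ` (W \<times> K \<times> K) \<subseteq> V"
          using xy less.prems by (auto simp: g_def W_def)
        show "V \<subseteq> g ` (W \<times> K \<times> K)"
        proof
          fix z assume z: "z \<in> V"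
          \<comment> \<open>Pairing with \<open>y\<close> isolates the multiple of \<open>x\<close>,
            and conversely. In characteristic two, adding the plane part removes it, and adding it
            again restores \<open>z\<close>.\<close>
          define u v where "u = B y z / c" and "v = B x z / c"
          have uv: "u \<in> K" "v \<in> K"
            using in_K inv_c by (auto simp: u_def v_def)
          have "g (z, u, v) \<in> V"
            using xy z uv less.prems by (auto simp: g_def)
          moreover have "B x (g (z, u, v)) = 0" "B y (g (z, u, v)) = 0"
            using c by (simp_all add: Bx By uv) (simp_all add: u_def v_def)
          ultimately have "g (z, u, v) \<in> W"
            by (simp add: W_def)
          moreover have "z = g (g (z, u, v), u, v)"
            by (simp add: g_def add_ac)
          ultimately show "z \<in> g ` (W \<times> K \<times> K)"
            using uv by blast
        qed
      qed
    qed
    then have g_bij: "card V = card W * (card K)\<^sup>2" "g ` (W \<times> K \<times> K) = V"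
      using bij_betw_same_card[of g "W \<times> K \<times> K" V] bij_betw_imp_surj_on[of g "W \<times> K \<times> K" V]
      by (simp_all add: card_cartesian_product power2_eq_square)
    have "x \<notin> W"
      using c by (simp add: W_def)
    then have "W \<subset> V"
      using xy by (auto simp: W_def)
    then have "card W < card V"
      by (simp add: psubset_card_mono)
    moreover have "z + z' \<in> W" if "z \<in> W" "z' \<in> W" for z z'
      using that less.prems by (simp add: W_def add_right)
    moreover have "u * z \<in> W" if "u \<in> K" "z \<in> W" for u z
      using that less.prems by (simp add: W_def scale)
    ultimately obtain j where j: "card W = card {z \<in> W. \<forall>w\<in>W. B z w = 0} * card K ^ (2 * j)"
      using less.hyps by blast
    \<comment> \<open>A vector orthogonal to \<open>V\<close> is orthogonal to \<open>x\<close> and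
      \<open>y\<close>, hence lies in \<open>W\<close>. A vector of \<open>W\<close> orthogonal to
      \<open>W\<close> is orthogonal to the plane as well, hence to \<open>V\<close>.\<close>
    have "{z \<in> V. \<forall>w\<in>V. B z w = 0} = {z \<in> W. \<forall>w\<in>W. B z w = 0}"
    proof (intro Set.set_eqI iffI)
      fix z assume "z \<in> {z \<in> V. \<forall>w\<in>V. B z w = 0}"
      then show "z \<in> {z \<in> W. \<forall>w\<in>W. B z w = 0}"
        using xy sym[of z] by (auto simp: W_def)
    next
      fix z assume z: "z \<in> {z \<in> W. \<forall>w\<in>W. B z w = 0}"
      have "B z (g (w, u, v)) = 0" if "w \<in> W" "u \<in> K" "v \<in> K" for w u v
      proof -
        have "B z w = 0" "B z x = 0" "B z y = 0"
          using z that(1) sym[of z x] sym[of z y] by (simp_all add: W_def)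
        then show ?thesis
          by (simp add: g_def add_right scale that)
      qed
      then have "\<forall>w\<in>V. B z w = 0"
        unfolding g_bij(2)[symmetric] by auto
      then show "z \<in> {z \<in> V. \<forall>w\<in>V. B z w = 0}"
        using z by (simp add: W_def)
    qed
    then show ?thesis
      using g_bij(1) j
      by (intro exI[of _ "Suc j"]) (simp add: power2_eq_square power_add mult_ac)
  qed
qed

text \<open>The conjugates of \<open>w\<close> repeat after \<open>n\<close> steps, so the
  \<open>2 * n\<close> terms cancel in pairs.\<close>

lemma rel_tr_subfield_zero:
  assumes "(w::'a) \<in> subfield2 (k * n)"
  shows "rel_tr k (2 * n) w = 0"
proof -
  have "(\<Sum>j\<in>{n..<2*n}. w ^ (2 ^ (k * j))) = (\<Sum>j\<in>{0..<n}. w ^ (2 ^ (k * j)))"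
  proof (rule sum.reindex_bij_witness[of _ "\<lambda>j. n + j" "\<lambda>j. j - n"])
    fix j assume "j \<in> {n..<2*n}"
    then have "k * j = (k * n) * 1 + k * (j - n)"
      by (simp add: algebra_simps)
    then show "w ^ (2 ^ (k * (j - n))) = w ^ (2 ^ (k * j))"
      using subfield2_power_add[OF assms, of 1 "k * (j - n)"] by simp
  qed auto
  moreover have "rel_tr k (2 * n) w
      = (\<Sum>j\<in>{0..<n}. w ^ (2 ^ (k * j))) + (\<Sum>j\<in>{n..<2*n}. w ^ (2 ^ (k * j)))"
    by (subst sum.atLeastLessThan_concat) (auto simp: rel_tr_def lessThan_atLeast0)
  ultimately show ?thesis by simp
qed

end

context kasami_code
begin

text \<open>Modulo \<open>s + l\<close>, \<open>2 * s\<close> is the negative of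
  \<open>2 * l\<close>. So \<open>d'\<close> is the degree of the fixed field of
  \<open>\<theta>\<close>.\<close>

lemma gcd_eq: "gcd (s + l) (2 * s) = gcd (s + l) (2 * l)"
proof -
  have "gcd (s + l) (2 * s) dvd 2 * (s + l) - 2 * s" "gcd (s + l) (2 * l) dvd 2 * (s + l) - 2 * l"
    by (intro dvd_diff_nat dvd_mult gcd_dvd1 gcd_dvd2)+
  then show ?thesis
    by (intro dvd_antisym gcd_greatest gcd_dvd1) simp_all
qed

lemma not_dvd_l: "\<not> s dvd l"
proof
  assume "s dvd l"
  then obtain k where "l = s * k" by auto
  then show False
    using l_pos l_less l_neq by (cases k; cases "k - 1") auto
qed

lemma gcd_less: "gcd s l < s"
proof -
  have "gcd s l \<noteq> s"
    using not_dvd_l gcd_dvd2[of s l] by metis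
  then show ?thesis
    using s_pos gcd_le1_nat[of s l] by linarith
qed

text \<open>The trace onto the field of order \<open>2 ^ d\<close> turns \<open>L a b\<close> into
  an alternating form over that field with the same radical. The rank is even and so is the
  dimension \<open>2 * n\<close> of the whole field, hence the radical has even dimension, which
  excludes the size \<open>2 ^ d\<close>.\<close>

lemma card_rad_even:
  assumes d': "gcd (s + l) (2 * l) = gcd s l" and a: "a \<in> subfield2 s" and "(a, b) \<noteq> (0, 0)"
  shows "card (rad a b) \<in> {1, 2 ^ (2 * gcd s l)}"
proof -
  define d n where "d = gcd s l" and "n = s div d"
  have d: "d > 0" "s = d * n" "d * (2 * n) = 2 * s" "d dvd l"
    using s_pos by (simp_all add: d_def n_def)
  then have n: "n > 0"
    using s_pos by (auto intro: Nat.gr0I)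
  define B where "B x y = rel_tr d (2 * n) (y * L a b x)" for x y
  note full = subfield2_full[OF d(3)]
  have scale: "B x (u * y) = u * B x y" if "u \<in> subfield2 d" for u x y
    using rel_tr_scale[OF that] by (simp add: B_def mult.assoc)
  \<comment> \<open>The term with \<open>a\<close> lies in the field of order \<open>2 ^ s\<close>,
    where this trace vanishes. The two terms with \<open>b\<close> are conjugate over the field of
    order \<open>2 ^ d\<close>, since \<open>d\<close> divides \<open>l\<close>, and cancel.\<close>
  have alt: "B x x = 0" for x
  proof -
    have "a * x ^ (2 ^ s + 1) \<in> subfield2 (d * n)"
      using subfield2_closed(4)[OF card_field a norm_in_subfield2] d by simp
    then have "rel_tr d (2 * n) (x * (a * x ^ (2 ^ s))) = 0"
      using rel_tr_subfield_zero by (simp add: mult_ac)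
    moreover have "rel_tr d (2 * n) (x * (b * x ^ (2 ^ l))) = rel_tr d (2 * n) (x * (b * x) ^ (2 ^ (2 * s - l)))"
    proof -
      obtain j where j: "l = d * j"
        using d by auto
      have "(x * (b * x) ^ (2 ^ (2 * s - l))) ^ (2 ^ (d * j)) = x * (b * x ^ (2 ^ l))"
        unfolding j[symmetric] frobenius_adjoint by (simp only: mult_ac)
      then show ?thesis
        using rel_tr_frobenius[OF d(3)] by metis
    qed
    ultimately show ?thesis
      by (simp add: B_def L_def distrib_left rel_tr_add)
  qed
  have "\<exists>j. card (UNIV :: 'a set) = card {x \<in> UNIV. \<forall>y\<in>UNIV. B x y = 0} * card (subfield2 d :: 'a set) ^ (2 * j)"
  proof (rule card_alternating_form)
    show "B x y \<in> subfield2 d" for x y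
      unfolding B_def by (rule rel_tr_in_subfield[OF full])
    show "B (x + y) z = B x z + B y z" "B x (y + z) = B x y + B x z" for x y z
      by (simp_all only: B_def L_add distrib_left distrib_right rel_tr_add)
  qed (simp_all only: scale alt UNIV_I)
  moreover have "(\<forall>y. B x y = 0) \<longleftrightarrow> x \<in> rad a b" for x
  proof
    assume *: "\<forall>y. B x y = 0"
    show "x \<in> rad a b"
    proof (rule ccontr)
      assume "x \<notin> rad a b"
      obtain y where "rel_tr d (2 * n) (y * L a b x) \<noteq> 0"
        by (rule rel_tr_nondegenerate[of "2 * n" d "L a b x"])
          (use n d(1) full that \<open>x \<notin> rad a b\<close> in \<open>simp_all add: d(3) rad_def\<close>)
      then show False
        using * by (simp add: B_def)
    qed
  qed (simp add: B_def rad_def rel_tr_0)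
  moreover have "card (subfield2 d :: 'a set) = 2 ^ d"
    using d by (intro card_subfield2_dvd[OF card_field]) (auto simp flip: d(3))
  ultimately obtain j where j: "2 ^ (2 * s) = card (rad a b) * 2 ^ (d * (2 * j))"
    by (auto simp: card_field simp flip: power_mult)
  have "card (rad a b) \<noteq> 2 ^ d"
  proof
    assume "card (rad a b) = 2 ^ d"
    then have "(2 :: nat) ^ (d * (2 * n)) = 2 ^ (d * (2 * j + 1))"
      using j by (simp add: d(3) flip: power_add)
    then have "d * (2 * n) = d * (2 * j + 1)"
      by (rule power_inject_exp[THEN iffD1, rotated]) simp
    then have "2 * n = 2 * j + 1"
      using d(1) by (simp only: mult_cancel1) simp
    then show False by presburger
  qed
  then show ?thesis
    using card_rad[OF assms(3)] by (simp add: gcd_eq d' d_def)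
qed

text \<open>\<open>2 * d\<close> divides \<open>s + l\<close>, so the two coprime quotients have an
  even sum, and they cannot both be even.\<close>

lemma odd_quotients:
  assumes "gcd (s + l) (2 * l) = 2 * d" and d: "d = gcd s l"
  obtains i j where "s = d * i" "l = d * j" "odd i" "odd j"
proof -
  have "d \<noteq> 0"
    using s_pos by (simp add: d)
  then obtain i j where ij: "s = d * i" "l = d * j" "coprime i j"
    using gcd_coprime_exists[of s l] unfolding d[symmetric] by (auto simp: mult.commute)
  have "2 * d dvd s + l"
    using gcd_dvd1[of "s + l" "2 * l"] unfolding assms(1) .
  then have "d * 2 dvd d * (i + j)"
    by (simp add: ij algebra_simps)
  then have "even (i + j)"
    using s_pos ij by simp
  moreover have "\<not> (even i \<and> even j)"
    using ij(3) coprime_common_divisor_nat[of i j 2] by auto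
  ultimately show ?thesis
    using that[of i j] ij(1,2) by auto
qed

text \<open>The quotient of \<open>s\<close> by \<open>d\<close> is odd and differs from 1. The
  bound ensures \<open>2 * d < s\<close> and that subtractions such as \<open>3 * s - 5 * d\<close>
  are exact.\<close>

lemma three_gcd_le:
  assumes "gcd (s + l) (2 * l) = 2 * d" and d: "d = gcd s l"
  shows "3 * d \<le> s"
proof -
  obtain i j where i: "s = d * i" "odd i"
    by (rule odd_quotients[OF assms])
  have "i \<noteq> 1"
    using gcd_less i(1) unfolding d[symmetric] by auto
  with i(2) have "3 \<le> i"
    by (auto elim!: oddE)
  then show ?thesis
    unfolding i(1) by simp
qed

text \<open>The form is constant on the orbits of the group of \<open>(2 ^ d + 1)\<close>-th roots of unity,
  which acts freely on the nonzero elements.\<close>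

lemma T_cong_one:
  assumes "gcd (s + l) (2 * l) = 2 * gcd s l"
  shows "2 ^ gcd s l + 1 dvd T a b 0 - 1"
proof -
  define d where "d = gcd s l"
  define N :: nat where "N = 2 ^ d + 1"
  define U where "U = {u :: 'a. u ^ N = 1}"
  obtain i j where ij: "s = d * i" "l = d * j" "odd i" "odd j"
    by (rule odd_quotients[OF assms[folded d_def] d_def])
  \<comment> \<open>Oddness of \<open>i\<close> and \<open>j\<close> enters here:
    \<open>u ^ N = 1\<close> makes both powers of \<open>u\<close> that occur in the form
    trivial.\<close>
  have dvd: "N dvd 2 ^ s + 1" "N dvd 2 ^ l + 1"
    using odd_power_plus_one_dvd ij by (auto simp: N_def)
  have "N dvd (2 ^ s + 1) * (2 ^ s - 1)"
    by (rule dvd_mult2[OF dvd(1)])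
  also have "(2 ^ s + 1) * (2 ^ s - 1) = CARD('a) - 1"
  proof -
    have "(k + 1) * (k - 1) = k * k - 1" for k :: nat
      by (cases k) auto
    then show ?thesis
      by (simp only: card_field mult_2 power_add)
  qed
  finally have "card U = N"
    unfolding U_def by (rule card_roots_of_unity)
  have unit: "u ^ (2 ^ s + 1) = 1" "u ^ (2 ^ l + 1) = 1" if "u \<in> U" for u
    using that dvd by (auto simp: U_def power_mult elim!: dvdE simp del: power_Suc)
  define g where "g x = chi (Q a b x)" for x
  have g: "g (u * x) = g x" if "u \<in> U" for u x
    unfolding g_def Q_def power_mult_distrib[of u] unit[OF that] by simp
  let ?S = "UNIV - {0 :: 'a}"
  \<comment> \<open>Each such fibre is a coset of \<open>U\<close>, on which \<open>g\<close> is
    constant. Only \<open>g 0 = 1\<close> then remains modulo \<open>N\<close>.\<close>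
  have "int N dvd (\<Sum>x\<in>{x \<in> ?S. x ^ N = y}. g x)" if "y \<in> (\<lambda>x. x ^ N) ` ?S" for y
  proof -
    from that obtain z where z: "z \<noteq> 0" "y = z ^ N"
      by auto
    have "{x \<in> ?S. x ^ N = y} = (\<lambda>u. u * z) ` U"
    proof (rule Set.set_eqI)
      fix x
      have "x / z \<in> U \<longleftrightarrow> x ^ N = y"
        using z by (simp add: U_def power_divide)
      moreover have "x \<noteq> 0" if "x ^ N = y"
        using that z by (auto simp: N_def)
      ultimately show "x \<in> {x \<in> ?S. x ^ N = y} \<longleftrightarrow> x \<in> (\<lambda>u. u * z) ` U"
        using in_scaled[OF z(1)] by blast
    qed
    then have "(\<Sum>x\<in>{x \<in> ?S. x ^ N = y}. g x) = (\<Sum>u\<in>U. g (u * z))"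
      using z by (simp add: sum.reindex inj_on_def)
    also have "\<dots> = int N * g z"
      using \<open>card U = N\<close> by (simp add: g)
    finally show ?thesis by simp
  qed
  then have "int N dvd (\<Sum>x\<in>?S. g x)"
    by (subst sum.image_gen[of _ _ "\<lambda>x. x ^ N"]) (auto intro: dvd_sum)
  moreover have "T a b 0 = (\<Sum>x\<in>UNIV. g x)"
    by (simp add: T_def g_def tr_0)
  moreover have "\<dots> = g 0 + (\<Sum>x\<in>?S. g x)"
    by (rule sum.remove) auto
  moreover have "g 0 = 1"
    by (simp add: g_def Q_def chi_def tr_0)
  ultimately show ?thesis
    by (simp add: N_def d_def add.commute)
qed

text \<open>\<open>T_square\<close> leaves 0 or plus or minus \<open>(2 ^ d) ^ (i + e)\<close>,
  where \<open>s = d * i\<close>, and the congruence selects \<open>(- (2 ^ d)) ^ (i + e)\<close>.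
  As \<open>i\<close> is odd, the sign is positive exactly for odd \<open>e\<close>.\<close>

lemma T_value:
  assumes "gcd (s + l) (2 * l) = 2 * gcd s l" "a \<in> subfield2 s"
    and rad: "card (rad a b) = 2 ^ (2 * (gcd s l * e))"
  shows "T a b 0 = (if odd e then 1 else - 1) * 2 ^ (s + gcd s l * e)"
proof -
  define d where "d = gcd s l"
  obtain i where i: "s = d * i" "odd i"
    by (rule odd_quotients[OF assms(1)[folded d_def] d_def])
  have "T a b 0 = (- (2 ^ d)) ^ (i + e)"
  proof (rule eq_power_of_cong_one)
    have "d * (2 * (i + e)) = 2 * s + 2 * (d * e)"
      by (simp add: i algebra_simps)
    then have "2 ^ (2 * s) * int (card (rad a b)) = (2 ^ d) ^ (2 * (i + e))"
      by (simp add: rad flip: d_def power_mult power_add)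
    then show "(T a b 0)\<^sup>2 = (2 ^ d) ^ (2 * (i + e)) \<or> T a b 0 = 0"
      using T_square[OF assms(2), of b 0] by auto
    show "2 ^ d + 1 dvd T a b 0 - 1"
      using T_cong_one[OF assms(1)] by (simp add: d_def)
    have "d > 0"
      using s_pos by (simp add: d_def)
    then show "2 \<le> (2 :: int) ^ d"
      using power_increasing[of 1 d "2 :: int"] by simp
  qed
  also have "\<dots> = (- 1) ^ (i + e) * 2 ^ (s + d * e)"
    by (simp add: power_minus[of "2 ^ d"] i algebra_simps flip: power_mult power_add)
  finally show ?thesis
    using i(2) by (simp add: d_def)
qed

end

section \<open>Designs from affine-invariant codes\<close>

lemma card_distinct_pairs:
  assumes "finite X"
  shows "card {(x, y). x \<in> X \<and> y \<in> X \<and> x \<noteq> y} = card X * (card X - 1)"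
proof -
  have "{(x, y). x \<in> X \<and> y \<in> X \<and> x \<noteq> y} = Sigma X (\<lambda>x. X - {x})"
    by auto
  then show ?thesis
    using assms by (simp add: card_Diff_singleton)
qed

lemma weight_comp_bij:
  assumes "bij \<sigma>"
  shows "weight (\<lambda>x. w (\<sigma> x)) = weight w"
proof -
  have "bij_betw \<sigma> {x. w (\<sigma> x) \<noteq> 0} {x. w x \<noteq> 0}"
    using assms by (auto simp: bij_betw_def bij_def inj_on_def surj_def)
  then show ?thesis
    unfolding weight_def by (rule bij_betw_same_card)
qed

lemma bij_affine:
  assumes "(u :: 'a::field) \<noteq> 0"
  shows "bij (\<lambda>x. u * x + v)"
  using assms by (intro bij_betwI[where g = "\<lambda>x. (x - v) / u"]) auto

text \<open>The map \<open>u * z + x\<close> with \<open>u = y - x\<close> takes 0 and 1 to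
  \<open>x\<close> and \<open>y\<close>, so the number of codewords of weight \<open>i\<close> that
  are nonzero at two given positions is the same for all pairs. Counting codewords together with
  ordered pairs in their supports gives the equation for \<open>n\<close>.\<close>

lemma affine_invariant_design:
  fixes C :: "('a::finite_field \<Rightarrow> 'a) set" and pos :: "'a \<Rightarrow> nat"
  defines "q \<equiv> CARD('a)"
  assumes pos: "bij_betw pos UNIV {0..<q}"
    and binary: "\<And>w x. w \<in> C \<Longrightarrow> w x \<in> {0, 1}"
    and affine: "\<And>w u v. w \<in> C \<Longrightarrow> u \<noteq> 0 \<Longrightarrow> (\<lambda>x. w (u * x + v)) \<in> C"
    and i: "2 \<le> i" "i \<le> q"
  shows "\<exists>n. design 2 q i n {0..<q} (weight_supports pos C i) \<and>
    n * (q * (q - 1)) = card {w \<in> C. weight w = i} * (i * (i - 1))"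
proof -
  define A where "A = {w \<in> C. weight w = i}"
  define N where "N x y = card {w \<in> A. w x \<noteq> 0 \<and> w y \<noteq> 0}" for x y
  have inj: "inj pos"
    using pos by (simp add: bij_betw_def)
  have shift: "(\<lambda>x. w (u * x + v)) \<in> A" if "w \<in> A" "u \<noteq> 0" for w u v
    using that affine weight_comp_bij[OF bij_affine] by (auto simp: A_def)
  have N: "N x y = N 0 1" if "x \<noteq> y" for x y
  proof -
    define u where "u = y - x"
    have u: "u \<noteq> 0" "u + x = y"
      using that by (simp_all add: u_def)
    have "bij_betw (\<lambda>w z. w (u * z + x)) {w \<in> A. w x \<noteq> 0 \<and> w y \<noteq> 0} {w \<in> A. w 0 \<noteq> 0 \<and> w 1 \<noteq> 0}"
    proof (rule bij_betwI[where g = "\<lambda>w z. w (inverse u * z + - (x * inverse u))"])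
      show "(\<lambda>w z. w (u * z + x)) \<in> {w \<in> A. w x \<noteq> 0 \<and> w y \<noteq> 0} \<rightarrow> {w \<in> A. w 0 \<noteq> 0 \<and> w 1 \<noteq> 0}"
        using shift[OF _ u(1)] u by auto
      have "inverse u * y + - (x * inverse u) = 1"
        using u(1) by (simp add: u(2)[symmetric] distrib_left mult.commute)
      then show "(\<lambda>w z. w (inverse u * z + - (x * inverse u)))
          \<in> {w \<in> A. w 0 \<noteq> 0 \<and> w 1 \<noteq> 0} \<rightarrow> {w \<in> A. w x \<noteq> 0 \<and> w y \<noteq> 0}"
        using shift[of _ "inverse u" "- (x * inverse u)"] u(1) by (auto simp: mult.commute)
      have "inverse u * (u * z + x) + - (x * inverse u) = z"
        "u * (inverse u * z + - (x * inverse u)) + x = z" for z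
        using u(1) by (simp_all add: field_simps)
      then show "(\<lambda>z. (\<lambda>z. w (u * z + x)) (inverse u * z + - (x * inverse u))) = w"
        "(\<lambda>z. (\<lambda>z. w (inverse u * z + - (x * inverse u))) (u * z + x)) = w" for w :: "'a \<Rightarrow> 'a"
        by simp_all
    qed
    then show ?thesis
      unfolding N_def by (rule bij_betw_same_card)
  qed
  have supp_iff: "pos x \<in> supp pos w \<longleftrightarrow> w x \<noteq> 0" for x and w :: "'a \<Rightarrow> 'a"
    using inj by (auto simp: supp_def inj_eq)
  \<comment> \<open>Binary words are determined by their supports, so counting blocks amounts to
    counting codewords.\<close>
  have inj_supp: "inj_on (supp pos) A"
  proof (rule inj_onI, rule ext)
    fix w w' x assume "w \<in> A" "w' \<in> A" "supp pos w = supp pos w'"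
    then have "w x \<in> {0, 1}" "w' x \<in> {0, 1}" "w x \<noteq> 0 \<longleftrightarrow> w' x \<noteq> 0"
      using binary supp_iff[of x w] supp_iff[of x w'] by (auto simp: A_def)
    then show "w x = w' x"
      by auto
  qed
  have blocks: "b \<subseteq> {0..<q} \<and> card b = i" if "b \<in> weight_supports pos C i" for b
  proof -
    from that obtain w :: "'a \<Rightarrow> 'a" where w: "b = supp pos w" "weight w = i"
      by (auto simp: weight_supports_def)
    then have "card b = i"
      using inj by (simp add: supp_def weight_def card_image inj_on_subset)
    moreover have "b \<subseteq> {0..<q}"
      using pos w by (auto simp: supp_def bij_betw_def)
    ultimately show ?thesis by blast
  qed
  have lam: "card {b \<in> weight_supports pos C i. P \<subseteq> b} = N 0 1" if "P \<subseteq> {0..<q}" "card P = 2" for P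
  proof -
    obtain p1 p2 where p: "P = {p1, p2}" "p1 \<noteq> p2"
      using \<open>card P = 2\<close> by (auto simp: card_2_iff)
    have "p1 \<in> range pos" "p2 \<in> range pos"
      using that p pos by (auto simp: bij_betw_def)
    then obtain x y where xy: "p1 = pos x" "p2 = pos y"
      by auto
    have "{b \<in> weight_supports pos C i. P \<subseteq> b} = supp pos ` {w \<in> A. w x \<noteq> 0 \<and> w y \<noteq> 0}"
      by (auto simp: weight_supports_def A_def p xy supp_iff)
    moreover have "inj_on (supp pos) {w \<in> A. w x \<noteq> 0 \<and> w y \<noteq> 0}"
      by (rule inj_on_subset[OF inj_supp]) auto
    ultimately have "card {b \<in> weight_supports pos C i. P \<subseteq> b} = N x y"
      by (simp add: card_image N_def)
    then show ?thesis
      using N[of x y] p xy by auto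
  qed
  have "design 2 q i (N 0 1) {0..<q} (weight_supports pos C i)"
    unfolding design_def using i blocks lam by auto
  moreover have "N 0 1 * (q * (q - 1)) = card A * (i * (i - 1))"
  proof -
    let ?D = "{(x, y). x \<in> (UNIV :: 'a set) \<and> y \<in> (UNIV :: 'a set) \<and> x \<noteq> y}"
    have "(\<Sum>p\<in>?D. N (fst p) (snd p)) = (\<Sum>p\<in>?D. N 0 1)"
      by (intro sum.cong refl N) auto
    then have "N 0 1 * (q * (q - 1)) = (\<Sum>p\<in>?D. N (fst p) (snd p))"
      using card_distinct_pairs[of "UNIV :: 'a set"] by (simp add: q_def mult.commute)
    also have "\<dots> = (\<Sum>p\<in>?D. \<Sum>w\<in>A. if w (fst p) \<noteq> 0 \<and> w (snd p) \<noteq> 0 then 1 else 0)"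
      by (intro sum.cong refl) (simp add: N_def sum.If_cases Int_def conj_commute)
    also have "\<dots> = (\<Sum>w\<in>A. \<Sum>p\<in>?D. if w (fst p) \<noteq> 0 \<and> w (snd p) \<noteq> 0 then 1 else 0)"
      by (rule sum.swap)
    also have "\<dots> = (\<Sum>w\<in>A. i * (i - 1))"
    proof (rule sum.cong[OF refl])
      fix w assume "w \<in> A"
      then have w: "card {x. w x \<noteq> 0} = i"
        by (simp add: A_def weight_def)
      have "?D \<inter> {p. w (fst p) \<noteq> 0 \<and> w (snd p) \<noteq> 0}
          = {(x, y). x \<in> {x. w x \<noteq> 0} \<and> y \<in> {x. w x \<noteq> 0} \<and> x \<noteq> y}"
        by auto
      then show "(\<Sum>p\<in>?D. if w (fst p) \<noteq> 0 \<and> w (snd p) \<noteq> 0 then 1 else 0) = i * (i - 1)"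
        using card_distinct_pairs[of "{x. w x \<noteq> 0}"] w by (simp add: sum.If_cases)
    qed
    finally show ?thesis by simp
  qed
  ultimately show ?thesis
    unfolding A_def by blast
qed

section \<open>Affine invariance of the code and its 2-designs\<close>

context kasami_code
begin

definition codeword :: "'a \<Rightarrow> 'a \<Rightarrow> 'a \<Rightarrow> 'a \<Rightarrow> 'a \<Rightarrow> 'a" where
  "codeword a b c h x = Q a b x + Tr (c * x) + h"

abbreviation code :: "('a \<Rightarrow> 'a) set" where
  "code \<equiv> trace_code s l"

lemma code_eq: "code = {codeword a b c h | a b c h. a \<in> subfield2 s \<and> h \<in> {0, 1}}"
proof -
  have "codeword a b c h
      = (\<lambda>x. tr s (a * x ^ (2 ^ s + 1)) + tr (2 * s) (b * x ^ (2 ^ l + 1) + c * x) + h)" for a b c h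
    by (rule ext) (simp add: codeword_def Q_def tr_add add.assoc)
  then show ?thesis
    by (simp only: trace_code_def)
qed

lemma codeword_binary:
  "a \<in> subfield2 s \<Longrightarrow> h \<in> {0, 1} \<Longrightarrow> codeword a b c h x \<in> {0, 1}"
  unfolding codeword_def by (intro binary_add Q_binary Tr_cases)

lemma codeword_add:
  "codeword (a + a') (b + b') (c + c') (h + h') x = codeword a b c h x + codeword a' b' c' h' x"
  by (simp add: codeword_def Q_def distrib_right tr_add add_ac)

text \<open>A position contributes 1 to the signed exponential sum if the codeword vanishes there,
  and -1 otherwise.\<close>

lemma codeword_weight:
  assumes "a \<in> subfield2 s" "h \<in> {0, 1}"
  shows "chi h * T a b c = 2 ^ (2 * s) - 2 * int (weight (codeword a b c h))"
proof -
  have "chi h * T a b c = (\<Sum>x\<in>UNIV. chi (codeword a b c h x))"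
    unfolding T_def codeword_def
    by (simp add: sum_distrib_left chi_add[OF binary_add[OF Q_binary[OF assms(1)] Tr_cases] assms(2)]
        mult.commute[of "chi h"])
  also have "\<dots> = (\<Sum>x\<in>(UNIV :: 'a set). 1) - 2 * (\<Sum>x\<in>UNIV. if codeword a b c h x \<noteq> 0 then 1 else 0)"
    unfolding sum_distrib_left sum_subtractf[symmetric] by (intro sum.cong refl) (simp add: chi_def)
  also have "\<dots> = 2 ^ (2 * s) - 2 * int (weight (codeword a b c h))"
    by (simp add: sum.If_cases card_field weight_def)
  finally show ?thesis .
qed

text \<open>Scaling by \<open>u\<close> multiplies \<open>a\<close> and \<open>b\<close> by powers
  of \<open>u\<close>, and \<open>a\<close> stays in the subfield because its factor is a norm. By
  polarisation, the shift by \<open>v\<close> affects only the linear and constant terms.\<close>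

lemma codeword_affine:
  assumes "a \<in> subfield2 s" "h \<in> {0, 1}"
  shows "(\<lambda>x. codeword a b c h (u * x + v)) \<in> code"
proof -
  have "codeword a b c h (u * x + v) = codeword (a * u ^ (2 ^ s + 1)) (b * u ^ (2 ^ l + 1))
      (u * L a b v + c * u) (Q a b v + Tr (c * v) + h) x" for x
  proof -
    have "Q a b (u * x) = Q (a * u ^ (2 ^ s + 1)) (b * u ^ (2 ^ l + 1)) x"
      unfolding Q_def power_mult_distrib by (simp only: mult.assoc)
    moreover have "Q a b (u * x + v) = Q a b (u * x) + Q a b v + Tr ((u * x) * L a b v)"
      unfolding add.commute[of "u * x" v] Q_add[OF assms(1)] by (simp add: add_ac)
    ultimately show ?thesis
      by (simp add: codeword_def distrib_left distrib_right tr_add mult_ac add_ac)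
  qed
  moreover have "a * u ^ (2 ^ s + 1) \<in> subfield2 s"
    by (rule subfield2_closed(4)[OF card_field assms(1) norm_in_subfield2])
  moreover have "Q a b v + Tr (c * v) + h \<in> {0, 1}"
    by (intro binary_add Q_binary Tr_cases assms)
  ultimately show ?thesis
    unfolding code_eq by blast
qed

lemma sixteen_le: "16 \<le> (2 :: int) ^ (2 * s)"
  using power_increasing[of 4 "2 * s" "2 :: int"] s_ge by simp

text \<open>Blocks of a 2-design need two points. With \<open>q = 2 ^ (2 * s)\<close>, weight 1
  would make the square of \<open>q - 2\<close> a multiple of \<open>q\<close>, so \<open>q\<close>
  would divide 4, whereas \<open>q\<close> is at least 16.\<close>

lemma weight_neq_one:
  assumes "w \<in> code"
  shows "weight w \<noteq> 1"
proof
  assume "weight w = 1"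
  obtain a b c h where w: "w = codeword a b c h" "a \<in> subfield2 s" "h \<in> {0, 1}"
    using assms unfolding code_eq by blast
  define q where "q = (2 :: int) ^ (2 * s)"
  have q: "16 \<le> q"
    using sixteen_le by (simp add: q_def)
  have "chi h * T a b c = q - 2"
    using codeword_weight[OF w(2,3), of b c] \<open>weight w = 1\<close> w(1) by (simp add: q_def)
  moreover have "(chi h * T a b c)\<^sup>2 = (T a b c)\<^sup>2"
    using chi_cases[of h] by auto
  ultimately have "(q - 2)\<^sup>2 = 0 \<or> (q - 2)\<^sup>2 = q * int (card (rad a b))"
    using T_square[OF w(2), of b c] by (auto simp: q_def)
  then have "q dvd (q - 2)\<^sup>2"
    by auto
  moreover have "(q - 2)\<^sup>2 = q * (q - 4) + 4"
    by (simp add: power2_eq_square algebra_simps)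
  ultimately have "q dvd 4"
    by (simp add: dvd_add_right_iff)
  then show False
    using zdvd_imp_le[of q 4] q by simp
qed

lemma code_design:
  fixes pos :: "'a \<Rightarrow> nat"
  assumes "bij_betw pos UNIV {0..<2 ^ (2 * s)}" "2 \<le> i" "i \<le> 2 ^ (2 * s)"
  shows "\<exists>n. design 2 (2 ^ (2 * s)) i n {0..<2 ^ (2 * s)} (weight_supports pos code i) \<and>
    n * (2 ^ (2 * s) * (2 ^ (2 * s) - 1)) = card {w \<in> code. weight w = i} * (i * (i - 1))"
proof -
  have binary: "w x \<in> {0, 1}" and affine: "(\<lambda>x. w (u * x + v)) \<in> code" if "w \<in> code" for w x u v
  proof -
    from that obtain a b c h where w: "w = codeword a b c h" "a \<in> subfield2 s" "h \<in> {0, 1}"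
      unfolding code_eq by blast
    show "w x \<in> {0, 1}"
      unfolding w(1) by (rule codeword_binary[OF w(2,3)])
    show "(\<lambda>x. w (u * x + v)) \<in> code"
      unfolding w(1) by (rule codeword_affine[OF w(2,3)])
  qed
  show ?thesis
    by (rule affine_invariant_design[where C = code, unfolded card_field])
      (rule assms binary affine | assumption)+
qed

lemma code_t_design:
  fixes pos :: "'a \<Rightarrow> nat"
  assumes "bij_betw pos UNIV {0..<2 ^ (2 * s)}" "1 \<le> weight w" "w \<in> code"
  shows "t_design 2 {0..<2 ^ (2 * s)} (weight_supports pos code (weight w))"
proof -
  have "weight w \<le> 2 ^ (2 * s)"
    unfolding weight_def card_field[symmetric] by (rule card_mono) auto
  moreover have "2 \<le> weight w"
    using weight_neq_one[OF assms(3)] assms(2) by linarith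
  ultimately show ?thesis
    using code_design[OF assms(1), of "weight w"] unfolding t_design_def by blast
qed

section \<open>Counting the codewords of a given weight\<close>

definition nondegenerate :: bool where
  "nondegenerate \<longleftrightarrow>
    (\<forall>a b. a \<in> subfield2 s \<longrightarrow> (a, b) \<noteq> (0, 0) \<longrightarrow> card (rad a b) \<noteq> 2 ^ (2 * s))"

text \<open>By additivity it suffices to treat the zero word. Its exponential sum has absolute value
  \<open>2 ^ (2 * s)\<close>, which requires a radical of full size, so \<open>nondegenerate\<close>
  gives \<open>a = b = 0\<close>. Position 0 then gives \<open>h = 0\<close>, and orthogonality
  gives \<open>c = 0\<close>.\<close>

lemma inj_codeword:
  assumes nondeg: nondegenerate
  shows "inj_on (\<lambda>((a, b), (c, h)). codeword a b c h) ((subfield2 s \<times> UNIV) \<times> (UNIV \<times> {0, 1}))"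
proof -
  have zero: "a = 0 \<and> b = 0 \<and> c = 0 \<and> h = 0"
    if a: "a \<in> subfield2 s" and h: "h \<in> {0, 1}" and eq: "\<And>x. codeword a b c h x = 0" for a b c h
  proof -
    have "weight (codeword a b c h) = 0"
      by (simp add: weight_def eq)
    then have "chi h * T a b c = 2 ^ (2 * s)"
      using codeword_weight[OF a h, of b c] by simp
    moreover have "(chi h * T a b c)\<^sup>2 = (T a b c)\<^sup>2"
      using chi_cases[of h] by auto
    ultimately have "(2 ^ (2 * s)) * (2 ^ (2 * s)) = 2 ^ (2 * s) * int (card (rad a b))"
      using T_square[OF a, of b c] by (auto simp: power2_eq_square)
    then have "int (2 ^ (2 * s)) = int (card (rad a b))"
      by (simp only: mult_cancel_left power_eq_0_iff of_nat_power of_nat_numeral) simp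
    then have "card (rad a b) = 2 ^ (2 * s)"
      by (simp only: of_nat_eq_iff)
    then have ab: "a = 0" "b = 0"
      using nondeg a unfolding nondegenerate_def by blast+
    have "h = 0"
      using eq[of 0] by (simp add: ab codeword_def Q_def tr_0)
    then have "Tr (x * c) = 0" for x
      using eq[of x] by (simp add: ab codeword_def Q_def tr_0 mult.commute)
    then have "(\<Sum>x\<in>UNIV. chi (Tr (x * c))) = int CARD('a)"
      by (simp add: chi_def)
    then have "c = 0"
      using sum_chi_Tr[of c] by (auto split: if_splits)
    with ab \<open>h = 0\<close> show ?thesis by simp
  qed
  show ?thesis
  proof (rule inj_onI)
    fix p p'
    assume mem: "p \<in> (subfield2 s \<times> UNIV) \<times> (UNIV \<times> {0, 1})" "p' \<in> (subfield2 s \<times> UNIV) \<times> (UNIV \<times> {0, 1})"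
      and "(\<lambda>((a, b), (c, h)). codeword a b c h) p = (\<lambda>((a, b), (c, h)). codeword a b c h) p'"
    moreover obtain a b c h a' b' c' h' where p: "p = ((a, b), (c, h))" "p' = ((a', b'), (c', h'))"
      by (metis surj_pair)
    ultimately have eq: "codeword a b c h = codeword a' b' c' h'"
      by (simp only: prod.case)
    have *: "a \<in> subfield2 s" "h \<in> {0, 1}" "a' \<in> subfield2 s" "h' \<in> {0, 1}"
      using mem by (simp_all only: p mem_Times_iff fst_conv snd_conv)
    have "a + a' = 0 \<and> b + b' = 0 \<and> c + c' = 0 \<and> h + h' = 0"
    proof (rule zero)
      show "codeword (a + a') (b + b') (c + c') (h + h') x = 0" for x
        unfolding codeword_add eq by simp
    qed (use * in \<open>simp_all only: binary_add subfield2_closed(3)[OF card_field]\<close>)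
    then show "p = p'"
      by (simp add: p add_eq_0_iff_eq)
  qed
qed

text \<open>Weight \<open>i\<close> means that the signed exponential sum equals \<open>v\<close>.
  The parametrisation is injective, so the counts of \<open>card_signed_T\<close> can be added over
  all forms.\<close>

lemma card_weight_class:
  fixes i :: nat
  assumes nondeg: nondegenerate
  defines "v \<equiv> 2 ^ (2 * s) - 2 * int i"
  shows "real (card {w \<in> code. weight w = i}) = (\<Sum>(a,b)\<in>subfield2 s \<times> UNIV.
    if v = 0 then 2 * (2 ^ (2 * s) - 2 ^ (2 * s) / real (card (rad a b)))
    else if v\<^sup>2 = 2 ^ (2 * s) * int (card (rad a b)) then 2 ^ (2 * s) / real (card (rad a b))
    else 0)"
proof -
  let ?P = "subfield2 s \<times> (UNIV :: 'a set)"
  let ?M = "\<lambda>(a, b). {(c, h :: 'a). h \<in> {0, 1} \<and> chi h * T a b c = v}"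
  let ?cw = "\<lambda>((a, b), (c, h)). codeword a b c h"
  have "{w \<in> code. weight w = i} = ?cw ` Sigma ?P ?M"
  proof (intro Set.set_eqI iffI)
    fix w assume "w \<in> {w \<in> code. weight w = i}"
    then obtain a b c h where w: "w = codeword a b c h" "a \<in> subfield2 s" "h \<in> {0, 1}" "weight w = i"
      unfolding code_eq by blast
    then have "((a, b), (c, h)) \<in> Sigma ?P ?M"
      using codeword_weight[of a h b c] by (simp add: v_def)
    then show "w \<in> ?cw ` Sigma ?P ?M"
      by (rule rev_image_eqI) (simp add: w(1))
  next
    fix w assume "w \<in> ?cw ` Sigma ?P ?M"
    then obtain a b c h where w: "w = codeword a b c h" "a \<in> subfield2 s" "h \<in> {0, 1}"
      "chi h * T a b c = v"
      by auto
    then have "weight w = i"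
      using codeword_weight[of a h b c] by (simp add: v_def)
    then show "w \<in> {w \<in> code. weight w = i}"
      using w unfolding code_eq by blast
  qed
  moreover have "inj_on ?cw (Sigma ?P ?M)"
    by (rule inj_on_subset[OF inj_codeword[OF nondeg]]) auto
  ultimately have "card {w \<in> code. weight w = i} = card (Sigma ?P ?M)"
    by (simp add: card_image)
  also have "\<dots> = (\<Sum>p\<in>?P. card (?M p))"
    by (rule card_SigmaI) auto
  finally have "real (card {w \<in> code. weight w = i}) = (\<Sum>p\<in>?P. real (card (?M p)))"
    by simp
  also have "\<dots> = (\<Sum>(a,b)\<in>?P.
    if v = 0 then 2 * (2 ^ (2 * s) - 2 ^ (2 * s) / real (card (rad a b)))
    else if v\<^sup>2 = 2 ^ (2 * s) * int (card (rad a b)) then 2 ^ (2 * s) / real (card (rad a b))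
    else 0)"
    by (intro sum.cong refl) (clarsimp simp only: prod.case card_signed_T mem_Times_iff fst_conv)
  finally show ?thesis .
qed

end

section \<open>Weight distribution\<close>

context kasami_code
begin

abbreviation forms :: "('a \<times> 'a) set" where
  "forms \<equiv> subfield2 s \<times> UNIV"

text \<open>Real-valued, because the counts are found from linear equations by division.\<close>

definition rad_count :: "nat \<Rightarrow> real" where
  "rad_count R = real (card {p \<in> forms. card (rad (fst p) (snd p)) = R})"

lemma sum_forms_by_rad:
  assumes "finite V" "(\<lambda>(a, b). card (rad a b)) ` forms \<subseteq> V"
  shows "(\<Sum>(a,b)\<in>forms. g (card (rad a b))) = (\<Sum>R\<in>V. rad_count R * g R)"
  unfolding case_prod_unfold rad_count_def
  by (rule sum_by_value[of forms V "\<lambda>p. card (rad (fst p) (snd p))" g]) (use assms in auto)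

lemma card_forms: "real (card forms) = (2 ^ s) ^ 3"
  by (simp add: card_cartesian_product card_subfield2[OF card_field s_pos] card_field
      flip: power_mult power_add)

lemma rad_count_full:
  assumes nondegenerate
  shows "rad_count (2 ^ (2 * s)) = 1"
proof -
  have "card (rad 0 0) = 2 ^ (2 * s)"
    by (simp add: rad_0 card_field)
  moreover have "p = (0, 0)" if "p \<in> forms" "card (rad (fst p) (snd p)) = 2 ^ (2 * s)" for p
    using assms that unfolding nondegenerate_def by (cases p) auto
  ultimately have "{p \<in> forms. card (rad (fst p) (snd p)) = 2 ^ (2 * s)} = {(0, 0)}"
    using subfield2_closed(1)[OF card_field, of s] by auto
  then show ?thesis
    by (simp add: rad_count_def)
qed

lemma sum_card_rad_real:
  "(\<Sum>(a,b)\<in>forms. real (card (rad a b)))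
    = (2 ^ s) ^ 3 + ((2 ^ s)\<^sup>2 - 1) * (2 ^ s * 2 ^ gcd s l)"
proof -
  have "(\<Sum>(a,b)\<in>forms. real (card (rad a b))) = real (\<Sum>(a,b)\<in>forms. card (rad a b))"
    by (simp add: case_prod_unfold)
  also have "\<dots> = 2 ^ (3 * s) + (2 ^ (2 * s) - 1) * 2 ^ (s + gcd s l)"
    unfolding sum_card_rad by (simp add: of_nat_diff)
  finally show ?thesis
    by (simp only: power_add mult.commute[of _ s] power_mult)
qed

lemma real_code_design:
  fixes pos :: "'a \<Rightarrow> nat"
  assumes pos: "bij_betw pos UNIV {0..<2 ^ (2 * s)}" and i: "2 \<le> i" "i \<le> 2 ^ (2 * s)"
    and lam: "lam = real (card {w \<in> code. weight w = i}) * (real i * (real i - 1))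
      / ((2 ^ s)\<^sup>2 * ((2 ^ s)\<^sup>2 - 1))"
  shows "\<exists>n. real n = lam \<and>
    design 2 (2 ^ (2 * s)) i n {0..<2 ^ (2 * s)} (weight_supports pos code i)"
proof -
  obtain n where n: "design 2 (2 ^ (2 * s)) i n {0..<2 ^ (2 * s)} (weight_supports pos code i)"
    and count: "n * (2 ^ (2 * s) * (2 ^ (2 * s) - 1)) = card {w \<in> code. weight w = i} * (i * (i - 1))"
    using code_design[OF pos i] by blast
  have q: "(2 :: real) ^ (2 * s) = (2 ^ s)\<^sup>2" "(1 :: real) < (2 ^ s)\<^sup>2"
    using s_pos by (simp_all add: power_mult mult.commute one_less_power)
  have "real n * (real (2 ^ (2 * s)) * (real (2 ^ (2 * s)) - 1))
      = real (n * (2 ^ (2 * s) * (2 ^ (2 * s) - 1)))"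
    by (simp add: of_nat_diff)
  also have "\<dots> = real (card {w \<in> code. weight w = i}) * (real i * (real i - 1))"
    unfolding count using i by (simp add: of_nat_diff)
  finally have "real n = lam"
    using q by (simp add: lam nonzero_eq_divide_eq)
  then show ?thesis
    using n by blast
qed

text \<open>The weight fixes the signed sum as \<open>\<epsilon> * 2 ^ s * 2 ^ e\<close>, whose
  square singles out the radical size \<open>2 ^ (2 * e)\<close>. Each form of that kind contributes
  \<open>2 ^ (2 * s - 2 * e)\<close> codewords, whatever the sign.\<close>

lemma nonmiddle_weight_design:
  fixes pos :: "'a \<Rightarrow> nat" and \<epsilon> :: real
  assumes nondeg: nondegenerate
    and pos: "bij_betw pos UNIV {0..<2 ^ (2 * s)}" and e: "e < s" and \<epsilon>: "\<epsilon> = 1 \<or> \<epsilon> = -1"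
    and i: "real i = ((2 ^ s)\<^sup>2 - \<epsilon> * 2 ^ s * 2 ^ e) / 2"
    and lam: "lam = rad_count (2 ^ (2 * e)) * (real i * (real i - 1)) / ((2 ^ e)\<^sup>2 * ((2 ^ s)\<^sup>2 - 1))"
  shows "\<exists>n. real n = lam \<and>
    design 2 (2 ^ (2 * s)) i n {0..<2 ^ (2 * s)} (weight_supports pos code i)"
proof (rule real_code_design[OF pos])
  define S E :: real where "S = 2 ^ s" and "E = 2 ^ e"
  have q: "(2 :: real) ^ (2 * s) = S\<^sup>2" "(2 :: real) ^ (2 * e) = E\<^sup>2"
    by (simp_all add: S_def E_def power_mult mult.commute)
  have E: "1 \<le> E"
    by (simp add: E_def)
  have "2 ^ Suc e \<le> (2 :: real) ^ s"
    using e by (intro power_increasing) auto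
  then have SE: "2 * E \<le> S"
    by (simp add: S_def E_def)
  have S4: "4 \<le> S"
    using power_increasing[of 2 s "2 :: real"] s_ge by (simp add: S_def)
  have iS: "real i = S * (S - \<epsilon> * E) / 2"
    using i by (simp add: S_def E_def power2_eq_square algebra_simps)
  \<comment> \<open>Because \<open>2 * E \<le> S\<close>, the weight lies between
    \<open>S / 2\<close> and \<open>S * S\<close>.\<close>
  have "S * 1 \<le> S * (S - \<epsilon> * E)" "S * (S - \<epsilon> * E) \<le> S * (2 * S)"
    using \<epsilon> SE S4 E by (auto intro!: mult_left_mono)
  then have "2 \<le> real i" "real i \<le> S\<^sup>2"
    using S4 unfolding iS power2_eq_square by linarith+
  moreover have "real (2 ^ (2 * s)) = S\<^sup>2"
    by (simp add: q)
  ultimately show "2 \<le> i" "i \<le> 2 ^ (2 * s)"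
    by linarith+
  define v where "v = 2 ^ (2 * s) - 2 * int i"
  have v: "real_of_int v = \<epsilon> * S * E"
  proof -
    have "real_of_int v = S\<^sup>2 - 2 * real i"
      by (simp add: v_def q)
    moreover have "2 * real i = S * (S - \<epsilon> * E)"
      by (simp add: iS)
    ultimately show ?thesis
      by (simp add: power2_eq_square algebra_simps)
  qed
  then have "v \<noteq> 0"
    using \<epsilon> E S4 by auto
  have "real_of_int (v\<^sup>2) = real_of_int (2 ^ (2 * s) * int (2 ^ (2 * e)))"
    using \<epsilon> by (auto simp: v q power_mult_distrib)
  then have vv: "v\<^sup>2 = 2 ^ (2 * s) * int (2 ^ (2 * e))"
    by (simp only: of_int_eq_iff)
  have iff: "v\<^sup>2 = 2 ^ (2 * s) * int R \<longleftrightarrow> R = 2 ^ (2 * e)" for R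
  proof -
    have "v\<^sup>2 = 2 ^ (2 * s) * int R \<longleftrightarrow> int (2 ^ (2 * e)) = int R"
      unfolding vv by simp
    then show ?thesis
      by (simp only: of_nat_eq_iff eq_commute)
  qed
  have "real (card {w \<in> code. weight w = i})
      = (\<Sum>(a,b)\<in>forms. if card (rad a b) = 2 ^ (2 * e) then S\<^sup>2 / E\<^sup>2 else 0)"
    unfolding card_weight_class[OF nondeg, of i, folded v_def]
    by (simp add: \<open>v \<noteq> 0\<close> iff q case_prod_unfold cong: if_cong)
  also have "\<dots> = rad_count (2 ^ (2 * e)) * (S\<^sup>2 / E\<^sup>2)"
    by (simp add: case_prod_unfold sum.If_cases rad_count_def Int_def)
  finally show "lam = real (card {w \<in> code. weight w = i}) * (real i * (real i - 1))
      / ((2 ^ s)\<^sup>2 * ((2 ^ s)\<^sup>2 - 1))"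
    unfolding lam S_def[symmetric] E_def[symmetric] using S4 by simp
qed

text \<open>Half the length is the weight exactly when the exponential sum vanishes. A form with
  radical size \<open>R\<close> has \<open>2 ^ (2 * s) - 2 ^ (2 * s) / R\<close> such
  \<open>c\<close>, each with both values of \<open>h\<close>.\<close>

lemma middle_weight_design:
  fixes pos :: "'a \<Rightarrow> nat"
  assumes nondeg: nondegenerate
    and pos: "bij_betw pos UNIV {0..<2 ^ (2 * s)}"
    and V: "finite V" "(\<lambda>(a, b). card (rad a b)) ` forms \<subseteq> V"
    and lam: "lam = ((2 ^ s)\<^sup>2 / 2 - 1) / ((2 ^ s)\<^sup>2 - 1)
      * (\<Sum>R\<in>V. rad_count R * ((2 ^ s)\<^sup>2 - (2 ^ s)\<^sup>2 / real R))"
  shows "\<exists>n. real n = lam \<and> design 2 (2 ^ (2 * s)) (2 ^ (2 * s - 1)) n {0..<2 ^ (2 * s)}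
    (weight_supports pos code (2 ^ (2 * s - 1)))"
proof (rule real_code_design[OF pos])
  have half: "(2 :: int) ^ (2 * s) = 2 * 2 ^ (2 * s - 1)" "(2 :: real) ^ (2 * s) = 2 * 2 ^ (2 * s - 1)"
    using s_pos by (simp_all flip: power_Suc)
  define S :: real where "S = 2 ^ s"
  have q: "(2 :: real) ^ (2 * s) = S\<^sup>2"
    by (simp add: S_def power_mult mult.commute)
  have S4: "4 \<le> S"
    using power_increasing[of 2 s "2 :: real"] s_ge by (simp add: S_def)
  show "2 \<le> (2 :: nat) ^ (2 * s - 1)" "(2 :: nat) ^ (2 * s - 1) \<le> 2 ^ (2 * s)"
    using s_pos power_increasing[of 1 "2 * s - 1" "2 :: nat"] by (simp_all add: power_increasing)
  have i: "real (2 ^ (2 * s - 1)) = S\<^sup>2 / 2"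
    using half(2) q by simp
  have "real (card {w \<in> code. weight w = 2 ^ (2 * s - 1)})
      = (\<Sum>(a,b)\<in>forms. 2 * (2 ^ (2 * s) - 2 ^ (2 * s) / real (card (rad a b))))"
  proof -
    have "2 ^ (2 * s) - 2 * int (2 ^ (2 * s - 1)) = 0"
      by (simp add: half(1))
    then show ?thesis
      by (subst card_weight_class[OF nondeg]) (simp_all only: if_True simp_thms)
  qed
  also have "\<dots> = (\<Sum>R\<in>V. rad_count R * (2 * (S\<^sup>2 - S\<^sup>2 / real R)))"
    unfolding q by (rule sum_forms_by_rad[OF V])
  also have "\<dots> = 2 * (\<Sum>R\<in>V. rad_count R * (S\<^sup>2 - S\<^sup>2 / real R))"
    by (simp add: sum_distrib_left algebra_simps)
  finally show "lam = real (card {w \<in> code. weight w = 2 ^ (2 * s - 1)})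
      * (real (2 ^ (2 * s - 1)) * (real (2 ^ (2 * s - 1)) - 1)) / ((2 ^ s)\<^sup>2 * ((2 ^ s)\<^sup>2 - 1))"
    unfolding lam i S_def[symmetric] using S4 by simp
qed

text \<open>The first equation counts the forms, the second adds their radical sizes. The zero form
  is kept apart: its radical is the whole field, whence the terms \<open>1\<close> and
  \<open>(2 ^ s)\<^sup>2\<close>.\<close>

lemma rad_count_case_one:
  assumes d: "d = gcd s l" and d': "gcd (s + l) (2 * l) = d"
  shows "rad_count 1 + rad_count (2 ^ (2 * d)) + 1 = (2 ^ s) ^ 3"
    and "rad_count 1 + rad_count (2 ^ (2 * d)) * (2 ^ d)\<^sup>2 + (2 ^ s)\<^sup>2
      = (2 ^ s) ^ 3 + ((2 ^ s)\<^sup>2 - 1) * (2 ^ s * 2 ^ d)"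
    and "(\<lambda>(a, b). card (rad a b)) ` forms \<subseteq> {1, 2 ^ (2 * d), 2 ^ (2 * s)}"
    and nondegenerate
    and "(\<Sum>R\<in>{1, 2 ^ (2 * d), 2 ^ (2 * s)}. rad_count R * g R)
      = rad_count 1 * g 1 + rad_count (2 ^ (2 * d)) * g (2 ^ (2 * d)) + g (2 ^ (2 * s))"
proof -
  have ds: "0 < d" "d < s"
    using gcd_less s_pos by (simp_all add: d)
  have neq: "(1 :: nat) \<noteq> 2 ^ (2 * d)" "(1 :: nat) \<noteq> 2 ^ (2 * s)" "(2 :: nat) ^ (2 * d) \<noteq> 2 ^ (2 * s)"
    using ds one_less_power[of "2 :: nat"] by (simp_all add: power_inject_exp less_imp_neq)
  note rad = card_rad_even[OF d'[unfolded d], folded d]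
  show nondeg: nondegenerate
    unfolding nondegenerate_def
  proof (intro allI impI)
    fix a b :: 'a assume "a \<in> subfield2 s" "(a, b) \<noteq> (0, 0)"
    from rad[OF this] show "card (rad a b) \<noteq> 2 ^ (2 * s)"
      using neq by force
  qed
  show V: "(\<lambda>(a, b). card (rad a b)) ` forms \<subseteq> {1, 2 ^ (2 * d), 2 ^ (2 * s)}"
  proof (rule image_subsetI)
    fix p assume "p \<in> forms"
    then show "(\<lambda>(a, b). card (rad a b)) p \<in> {1, 2 ^ (2 * d), 2 ^ (2 * s)}"
      using rad[of "fst p" "snd p"] by (cases "p = (0, 0)"; cases p) (auto simp: rad_0 card_field)
  qed
  show expand: "(\<Sum>R\<in>{1, 2 ^ (2 * d), 2 ^ (2 * s)}. rad_count R * g R)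
      = rad_count 1 * g 1 + rad_count (2 ^ (2 * d)) * g (2 ^ (2 * d)) + g (2 ^ (2 * s))" for g
    using neq rad_count_full[OF nondeg] by simp
  have "finite {1, 2 ^ (2 * d), 2 ^ (2 * s) :: nat}"
    by simp
  note sum = sum_forms_by_rad[OF this V, unfolded expand]
  show "rad_count 1 + rad_count (2 ^ (2 * d)) + 1 = (2 ^ s) ^ 3"
    using sum[of "\<lambda>_. 1"] card_forms by simp
  show "rad_count 1 + rad_count (2 ^ (2 * d)) * (2 ^ d)\<^sup>2 + (2 ^ s)\<^sup>2
      = (2 ^ s) ^ 3 + ((2 ^ s)\<^sup>2 - 1) * (2 ^ s * 2 ^ d)"
    using sum[of real] sum_card_rad_real
    by (simp add: d[symmetric] mult.commute[of 2] power_mult)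
qed

text \<open>A third radical size is possible, so a third equation is needed: the sum of
  \<open>T a b 0\<close> over all forms, where each value, sign included, is determined by the
  radical size.\<close>

lemma rad_count_case_two:
  assumes d: "d = gcd s l" and d': "gcd (s + l) (2 * l) = 2 * d"
  shows "rad_count 1 + rad_count (2 ^ (2 * d)) + rad_count (2 ^ (4 * d)) + 1 = (2 ^ s) ^ 3"
    and "rad_count 1 + rad_count (2 ^ (2 * d)) * (2 ^ d)\<^sup>2 + rad_count (2 ^ (4 * d)) * (2 ^ d) ^ 4
      + (2 ^ s)\<^sup>2 = (2 ^ s) ^ 3 + ((2 ^ s)\<^sup>2 - 1) * (2 ^ s * 2 ^ d)"
    and "- rad_count 1 * 2 ^ s + rad_count (2 ^ (2 * d)) * (2 ^ s * 2 ^ d)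
      - rad_count (2 ^ (4 * d)) * (2 ^ s * (2 ^ d)\<^sup>2) + (2 ^ s)\<^sup>2 = (2 ^ s) ^ 3"
    and "(\<lambda>(a, b). card (rad a b)) ` forms \<subseteq> {1, 2 ^ (2 * d), 2 ^ (4 * d), 2 ^ (2 * s)}"
    and nondegenerate
    and "(\<Sum>R\<in>{1, 2 ^ (2 * d), 2 ^ (4 * d), 2 ^ (2 * s)}. rad_count R * g R)
      = rad_count 1 * g 1 + rad_count (2 ^ (2 * d)) * g (2 ^ (2 * d))
        + rad_count (2 ^ (4 * d)) * g (2 ^ (4 * d)) + g (2 ^ (2 * s))"
proof -
  have ds: "0 < d" "3 * d \<le> s"
    using three_gcd_le[OF d' d] s_pos by (simp_all add: d)
  have neq: "(1 :: nat) \<noteq> 2 ^ (2 * d)" "(1 :: nat) \<noteq> 2 ^ (4 * d)" "(1 :: nat) \<noteq> 2 ^ (2 * s)"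
    "(2 :: nat) ^ (2 * d) \<noteq> 2 ^ (4 * d)" "(2 :: nat) ^ (2 * d) \<noteq> 2 ^ (2 * s)"
    "(2 :: nat) ^ (4 * d) \<noteq> 2 ^ (2 * s)"
    using ds one_less_power[of "2 :: nat"] by (simp_all add: power_inject_exp less_imp_neq)
  have rad: "card (rad a b) \<in> {1, 2 ^ (2 * d), 2 ^ (4 * d)}" if "(a, b) \<noteq> (0, 0)" for a b
    using card_rad[OF that] by (simp add: gcd_eq d')
  show nondeg: nondegenerate
    unfolding nondegenerate_def
  proof (intro allI impI)
    fix a b :: 'a assume "(a, b) \<noteq> (0, 0)"
    from rad[OF this] show "card (rad a b) \<noteq> 2 ^ (2 * s)"
      using neq by force
  qed
  show V: "(\<lambda>(a, b). card (rad a b)) ` forms \<subseteq> {1, 2 ^ (2 * d), 2 ^ (4 * d), 2 ^ (2 * s)}"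
  proof (rule image_subsetI)
    fix p assume "p \<in> forms"
    show "(\<lambda>(a, b). card (rad a b)) p \<in> {1, 2 ^ (2 * d), 2 ^ (4 * d), 2 ^ (2 * s)}"
      using rad[of "fst p" "snd p"] by (cases "p = (0, 0)"; cases p) (auto simp: rad_0 card_field)
  qed
  show expand: "(\<Sum>R\<in>{1, 2 ^ (2 * d), 2 ^ (4 * d), 2 ^ (2 * s)}. rad_count R * g R)
      = rad_count 1 * g 1 + rad_count (2 ^ (2 * d)) * g (2 ^ (2 * d))
        + rad_count (2 ^ (4 * d)) * g (2 ^ (4 * d)) + g (2 ^ (2 * s))" for g
    using neq rad_count_full[OF nondeg] by simp
  have "finite {1, 2 ^ (2 * d), 2 ^ (4 * d), 2 ^ (2 * s) :: nat}"
    by simp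
  note sum = sum_forms_by_rad[OF this V, unfolded expand]
  show "rad_count 1 + rad_count (2 ^ (2 * d)) + rad_count (2 ^ (4 * d)) + 1 = (2 ^ s) ^ 3"
    using sum[of "\<lambda>_. 1"] card_forms by simp
  show "rad_count 1 + rad_count (2 ^ (2 * d)) * (2 ^ d)\<^sup>2 + rad_count (2 ^ (4 * d)) * (2 ^ d) ^ 4
      + (2 ^ s)\<^sup>2 = (2 ^ s) ^ 3 + ((2 ^ s)\<^sup>2 - 1) * (2 ^ s * 2 ^ d)"
    using sum[of real] sum_card_rad_real
    by (simp add: d[symmetric] mult.commute[of 2] mult.commute[of 4] power_mult)
  \<comment> \<open>\<open>T a b 0\<close> as a function of the radical size; the last value belongs
    to the zero form.\<close>
  define t :: "nat \<Rightarrow> real" where "t R = (if R = 1 then - (2 ^ s) else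
    if R = 2 ^ (2 * d) then 2 ^ s * 2 ^ d else if R = 2 ^ (4 * d) then - (2 ^ s * (2 ^ d)\<^sup>2)
    else (2 ^ s)\<^sup>2)" for R
  have t: "real_of_int (T a b 0) = t (card (rad a b))" if a: "a \<in> subfield2 s" for a b
  proof (cases "(a, b) = (0, 0)")
    case True
    have "T 0 0 0 = 2 ^ (2 * s)"
      by (simp add: T_def Q_def tr_0 chi_def card_field)
    then show ?thesis
      using True neq s_pos by (simp add: t_def rad_0 card_field power_mult mult.commute[of 2])
  next
    case False
    \<comment> \<open>Applied with \<open>e\<close> equal to 0, 1 and 2, one value for each radical
      size.\<close>
    note T = T_value[OF d'[unfolded d] a, folded d]
    consider "card (rad a b) = 1" | "card (rad a b) = 2 ^ (2 * d)" | "card (rad a b) = 2 ^ (4 * d)"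
      using rad[OF False] by auto
    moreover have "(4 :: real) ^ d = (2 ^ d)\<^sup>2"
      by (simp add: power2_eq_square flip: power_mult_distrib)
    ultimately show ?thesis
      using neq T[of b 0] T[of b 1] T[of b 2]
      by cases (auto simp: t_def power_add power_mult mult.commute[of _ 2])
  qed
  have "real_of_int (\<Sum>(a,b)\<in>forms. T a b 0) = (\<Sum>(a,b)\<in>forms. t (card (rad a b)))"
    by (simp add: case_prod_unfold t mem_Times_iff)
  then have "(\<Sum>(a,b)\<in>forms. t (card (rad a b))) = (2 ^ s) ^ 3"
    by (simp add: sum_T power_mult mult.commute[of 3])
  with sum[of t] have "rad_count 1 * t 1 + rad_count (2 ^ (2 * d)) * t (2 ^ (2 * d))
      + rad_count (2 ^ (4 * d)) * t (2 ^ (4 * d)) + t (2 ^ (2 * s)) = (2 ^ s) ^ 3"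
    by simp
  then show "- rad_count 1 * 2 ^ s + rad_count (2 ^ (2 * d)) * (2 ^ s * 2 ^ d)
      - rad_count (2 ^ (4 * d)) * (2 ^ s * (2 ^ d)\<^sup>2) + (2 ^ s)\<^sup>2 = (2 ^ s) ^ 3"
    using neq neq[symmetric] s_pos by (simp add: t_def)
qed

end

section \<open>The parameters\<close>

lemma power5_eq: "(x :: 'a::monoid_mult) ^ 5 = x * x * x * x * x"
  by (simp add: eval_nat_numeral mult.assoc)

lemmas ring_simps = algebra_simps power2_eq_square power3_eq_cube power4_eq_xxxx power5_eq

text \<open>To be read with \<open>S = 2 ^ s\<close> and \<open>D = 2 ^ d\<close>; \<open>n0\<close>
  and \<open>n1\<close> stand for the numbers of forms with radical size 1 and
  \<open>D\<^sup>2\<close>.\<close>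

lemma case_one_counts_solved:
  fixes n0 n1 S D :: real
  assumes D: "1 < D" and e1: "n0 + n1 + 1 = S ^ 3"
    and e2: "n0 + n1 * D\<^sup>2 + S\<^sup>2 = S ^ 3 + (S\<^sup>2 - 1) * (S * D)"
  shows "n1 = (S\<^sup>2 - 1) * (S * D - 1) / (D\<^sup>2 - 1)"
    and "n0 = (S - 1) * (S\<^sup>2 * D\<^sup>2 - S\<^sup>2 * D - S\<^sup>2 + S * D\<^sup>2 - S * D + D\<^sup>2) / (D\<^sup>2 - 1)"
proof -
  have nz: "D\<^sup>2 - 1 \<noteq> 0"
    using one_less_power[OF D, of 2] by simp
  have "n1 * (D\<^sup>2 - 1) = (n0 + n1 * D\<^sup>2 + S\<^sup>2) - (n0 + n1 + 1) - S\<^sup>2 + 1"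
    by (simp add: algebra_simps)
  also have "\<dots> = (S\<^sup>2 - 1) * (S * D - 1)"
    unfolding e1 e2 by (simp add: ring_simps)
  finally show "n1 = (S\<^sup>2 - 1) * (S * D - 1) / (D\<^sup>2 - 1)"
    using nz by (simp add: nonzero_eq_divide_eq)
  have "n0 * (D\<^sup>2 - 1) = D\<^sup>2 * (n0 + n1 + 1) - (n0 + n1 * D\<^sup>2 + S\<^sup>2) - D\<^sup>2 + S\<^sup>2"
    by (simp add: algebra_simps)
  also have "\<dots> = (S - 1) * (S\<^sup>2 * D\<^sup>2 - S\<^sup>2 * D - S\<^sup>2 + S * D\<^sup>2 - S * D + D\<^sup>2)"
    unfolding e1 e2 by (simp add: ring_simps)
  finally show "n0 = (S - 1) * (S\<^sup>2 * D\<^sup>2 - S\<^sup>2 * D - S\<^sup>2 + S * D\<^sup>2 - S * D + D\<^sup>2) / (D\<^sup>2 - 1)"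
    using nz by (simp add: nonzero_eq_divide_eq)
qed

lemma case_two_counts_solved:
  fixes n0 n1 n2 S D :: real
  assumes D: "1 < D" and S: "1 < S" and e1: "n0 + n1 + n2 + 1 = S ^ 3"
    and e2: "n0 + n1 * D\<^sup>2 + n2 * D ^ 4 + S\<^sup>2 = S ^ 3 + (S\<^sup>2 - 1) * (S * D)"
    and e3: "- n0 * S + n1 * (S * D) - n2 * (S * D\<^sup>2) + S\<^sup>2 = S ^ 3"
  shows "n2 = (S\<^sup>2 - 1) * (S - D) / (D * (D + 1) * (D\<^sup>2 - 1))"
    and "n1 = (S\<^sup>2 - 1) * (S * D\<^sup>2 + S * D + S + D\<^sup>2) / (D * (D + 1)\<^sup>2)"
    and "n0 = (S - 1) * (D ^ 3 * S\<^sup>2 - D * S\<^sup>2 - S\<^sup>2 + D ^ 3 * S - D\<^sup>2 * S + D ^ 3) / ((D\<^sup>2 - 1) * (D + 1))"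
proof -
  have nz: "D\<^sup>2 - 1 \<noteq> 0" "D \<noteq> 0" "D + 1 \<noteq> 0"
    using one_less_power[OF D, of 2] D by linarith+
  have "S * (- n0 + n1 * D - n2 * D\<^sup>2 + S) = - n0 * S + n1 * (S * D) - n2 * (S * D\<^sup>2) + S\<^sup>2"
    by (simp add: ring_simps)
  also have "\<dots> = S * S\<^sup>2"
    unfolding e3 by (simp add: ring_simps)
  finally have e3': "- n0 + n1 * D - n2 * D\<^sup>2 + S = S\<^sup>2"
    using S by simp
  \<comment> \<open>Both \<open>e2\<close> minus \<open>e1\<close> and \<open>e1\<close> plus
    \<open>e3'\<close> are free of \<open>n0\<close>; weighting the latter by \<open>D - 1\<close>
    eliminates \<open>n1\<close>.\<close>
  have "n2 * (D * (D + 1) * (D\<^sup>2 - 1))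
      = (n0 + n1 * D\<^sup>2 + n2 * D ^ 4 + S\<^sup>2) - S\<^sup>2 - (n0 + n1 + n2 + 1) + 1
        + (D - 1) * (S - (- n0 + n1 * D - n2 * D\<^sup>2 + S) - (n0 + n1 + n2 + 1) + 1)"
    by (simp add: ring_simps)
  also have "\<dots> = (S\<^sup>2 - 1) * (S - D)"
    unfolding e1 e2 e3' by (simp add: ring_simps)
  finally have n2: "n2 * (D * (D + 1) * (D\<^sup>2 - 1)) = (S\<^sup>2 - 1) * (S - D)" .
  then show "n2 = (S\<^sup>2 - 1) * (S - D) / (D * (D + 1) * (D\<^sup>2 - 1))"
    using nz by (simp add: nonzero_eq_divide_eq)
  \<comment> \<open>The sum of \<open>e1\<close> and \<open>e3'\<close> again, now solved for
    \<open>n1\<close> with \<open>n2\<close> known.\<close>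
  have "n1 * (D * (D + 1)\<^sup>2) = n2 * (D * (D + 1) * (D\<^sup>2 - 1))
      - D * (D + 1) * (S - (- n0 + n1 * D - n2 * D\<^sup>2 + S) - (n0 + n1 + n2 + 1) + 1)"
    by (simp add: ring_simps)
  also have "\<dots> = (S\<^sup>2 - 1) * (S * D\<^sup>2 + S * D + S + D\<^sup>2)"
    unfolding n2 e1 e3' by (simp add: ring_simps)
  finally have n1: "n1 * (D * (D + 1)\<^sup>2) = (S\<^sup>2 - 1) * (S * D\<^sup>2 + S * D + S + D\<^sup>2)" .
  then show "n1 = (S\<^sup>2 - 1) * (S * D\<^sup>2 + S * D + S + D\<^sup>2) / (D * (D + 1)\<^sup>2)"
    using nz by (simp add: nonzero_eq_divide_eq)
  \<comment> \<open>\<open>e1\<close> over the common denominator of \<open>n1\<close> and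
    \<open>n2\<close>; the extra factor \<open>D * (D + 1)\<close> cancels at the end.\<close>
  have "D * (D + 1) * (n0 * ((D\<^sup>2 - 1) * (D + 1)))
      = ((n0 + n1 + n2 + 1) - 1) * (D * (D + 1)\<^sup>2 * (D\<^sup>2 - 1))
        - (D\<^sup>2 - 1) * (n1 * (D * (D + 1)\<^sup>2)) - (D + 1) * (n2 * (D * (D + 1) * (D\<^sup>2 - 1)))"
    by (simp add: ring_simps)
  also have "\<dots> = D * (D + 1) * ((S - 1) * (D ^ 3 * S\<^sup>2 - D * S\<^sup>2 - S\<^sup>2 + D ^ 3 * S - D\<^sup>2 * S + D ^ 3))"
    unfolding e1 n1 n2 by (simp add: ring_simps)
  finally have "n0 * ((D\<^sup>2 - 1) * (D + 1)) = (S - 1) * (D ^ 3 * S\<^sup>2 - D * S\<^sup>2 - S\<^sup>2 + D ^ 3 * S - D\<^sup>2 * S + D ^ 3)"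
    using nz by (simp only: mult_cancel_left) simp
  then show "n0 = (S - 1) * (D ^ 3 * S\<^sup>2 - D * S\<^sup>2 - S\<^sup>2 + D ^ 3 * S - D\<^sup>2 * S + D ^ 3) / ((D\<^sup>2 - 1) * (D + 1))"
    using nz by (simp add: nonzero_eq_divide_eq)
qed

text \<open>Over the denominator \<open>D ^ 5\<close> the long bracket is
  \<open>S\<^sup>2 * Z / D ^ 5 + 1\<close>; on the right, the factor \<open>D + 1\<close> in the
  denominators of \<open>n1\<close> and \<open>n2\<close> cancels. The term with \<open>n0\<close>
  is zero: a form with trivial radical has no vanishing sum.\<close>

lemma case_two_middle:
  fixes n0 n1 n2 S D :: real
  assumes D: "1 < D" and S: "1 < S"
    and n1: "n1 = (S\<^sup>2 - 1) * (S * D\<^sup>2 + S * D + S + D\<^sup>2) / (D * (D + 1)\<^sup>2)"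
    and n2: "n2 = (S\<^sup>2 - 1) * (S - D) / (D * (D + 1) * (D\<^sup>2 - 1))"
  shows "(S\<^sup>2 / 2 - 1) * (S ^ 3 / D - S ^ 3 / D\<^sup>2 + S ^ 3 / D ^ 3 - S ^ 3 / D ^ 4 + S ^ 3 / D ^ 5
      + S\<^sup>2 / D - 2 * S\<^sup>2 / D\<^sup>2 + S\<^sup>2 / D ^ 3 - S\<^sup>2 / D ^ 4 + 1)
    = (S\<^sup>2 / 2 - 1) / (S\<^sup>2 - 1) * (n0 * (S\<^sup>2 - S\<^sup>2 / 1) + n1 * (S\<^sup>2 - S\<^sup>2 / D\<^sup>2)
      + n2 * (S\<^sup>2 - S\<^sup>2 / D ^ 4) + (S\<^sup>2 - S\<^sup>2 / S\<^sup>2))"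
proof -
  define Z where "Z = S * D ^ 4 - S * D ^ 3 + S * D\<^sup>2 - S * D + S + D ^ 4 - 2 * D ^ 3 + D\<^sup>2 - D"
  have nz: "D\<^sup>2 - 1 \<noteq> 0" "D \<noteq> 0" "D + 1 \<noteq> 0" "S\<^sup>2 - 1 \<noteq> 0" "S \<noteq> 0"
    using one_less_power[OF D, of 2] one_less_power[OF S, of 2] D S by linarith+
  have "S\<^sup>2 - S\<^sup>2 / D\<^sup>2 = S\<^sup>2 * (D - 1) * (D + 1) / D\<^sup>2"
    using nz(2) by (simp add: field_simps power2_eq_square)
  then have "n1 * (S\<^sup>2 - S\<^sup>2 / D\<^sup>2)
      = (S\<^sup>2 - 1) * S\<^sup>2 * ((S * D\<^sup>2 + S * D + S + D\<^sup>2) * (D - 1) * D\<^sup>2) / (D ^ 5 * (D + 1))"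
    using nz(2,3) by (simp add: n1 power2_eq_square power5_eq mult_ac)
  moreover have "S\<^sup>2 - S\<^sup>2 / D ^ 4 = S\<^sup>2 * (D\<^sup>2 - 1) * (D\<^sup>2 + 1) / D ^ 4"
    using nz(2) by (simp add: field_simps power2_eq_square power4_eq_xxxx)
  then have "n2 * (S\<^sup>2 - S\<^sup>2 / D ^ 4) = (S\<^sup>2 - 1) * S\<^sup>2 * ((S - D) * (D\<^sup>2 + 1)) / (D ^ 5 * (D + 1))"
    using nz(1-3) by (simp add: n2 power4_eq_xxxx power5_eq mult_ac)
  moreover have "(S * D\<^sup>2 + S * D + S + D\<^sup>2) * (D - 1) * D\<^sup>2 + (S - D) * (D\<^sup>2 + 1) = Z * (D + 1)"
    by (simp add: Z_def ring_simps)
  ultimately have "n1 * (S\<^sup>2 - S\<^sup>2 / D\<^sup>2) + n2 * (S\<^sup>2 - S\<^sup>2 / D ^ 4)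
      = (S\<^sup>2 - 1) * S\<^sup>2 * (Z * (D + 1)) / (D ^ 5 * (D + 1))"
    by (simp only: add_divide_distrib[symmetric] distrib_left[symmetric])
  also have "\<dots> = (S\<^sup>2 - 1) * (S\<^sup>2 * Z / D ^ 5)"
    using nz(3) by simp
  finally have "n0 * (S\<^sup>2 - S\<^sup>2 / 1) + n1 * (S\<^sup>2 - S\<^sup>2 / D\<^sup>2) + n2 * (S\<^sup>2 - S\<^sup>2 / D ^ 4) + (S\<^sup>2 - S\<^sup>2 / S\<^sup>2)
      = (S\<^sup>2 - 1) * (S\<^sup>2 * Z / D ^ 5 + 1)"
    using nz(5) by (simp add: distrib_left)
  moreover have "S ^ 3 / D - S ^ 3 / D\<^sup>2 + S ^ 3 / D ^ 3 - S ^ 3 / D ^ 4 + S ^ 3 / D ^ 5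
      + S\<^sup>2 / D - 2 * S\<^sup>2 / D\<^sup>2 + S\<^sup>2 / D ^ 3 - S\<^sup>2 / D ^ 4 = S\<^sup>2 * Z / D ^ 5"
  proof -
    have expand: "x / D = x * D ^ 4 / D ^ 5" "x / D\<^sup>2 = x * D ^ 3 / D ^ 5"
      "x / D ^ 3 = x * D\<^sup>2 / D ^ 5" "x / D ^ 4 = x * D / D ^ 5" for x
      using nz(2) by (simp_all add: power2_eq_square power3_eq_cube power4_eq_xxxx power5_eq)
    show ?thesis
      unfolding expand add_divide_distrib[symmetric] diff_divide_distrib[symmetric]
      by (rule arg_cong[where f = "\<lambda>x. x / D ^ 5"]) (simp add: Z_def ring_simps)
  qed
  ultimately show ?thesis
    using nz(4) by simp
qed

section \<open>Assembling the designs\<close>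

context kasami_code
begin

text \<open>Both signs of the exponential sum occur for radical size \<open>2 ^ (2 * e)\<close>, and
  half of \<open>S * E\<close> is \<open>2 ^ k\<close>. The relevant values of \<open>e\<close> are
  0, \<open>d\<close> and \<open>2 * d\<close>.\<close>

lemma signed_weight_design:
  fixes pos :: "'a \<Rightarrow> nat" and k :: nat
  assumes nondeg: nondegenerate
    and pos: "bij_betw pos UNIV {0..<2 ^ (2 * s)}" and e: "e < s" and k: "k = s + e - 1"
    and S: "S = 2 ^ s" and E: "E = 2 ^ e"
  shows "lam = rad_count (2 ^ (2 * e)) * ((S\<^sup>2 - S * E) / 2 * ((S\<^sup>2 - S * E) / 2 - 1)) / (E\<^sup>2 * (S\<^sup>2 - 1)) \<Longrightarrow>
      \<exists>n. real n = lam \<and> design 2 (2 ^ (2 * s)) (2 ^ (2 * s - 1) - 2 ^ k) n {0..<2 ^ (2 * s)}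
        (weight_supports pos code (2 ^ (2 * s - 1) - 2 ^ k))"
    and "lam = rad_count (2 ^ (2 * e)) * ((S\<^sup>2 + S * E) / 2 * ((S\<^sup>2 + S * E) / 2 - 1)) / (E\<^sup>2 * (S\<^sup>2 - 1)) \<Longrightarrow>
      \<exists>n. real n = lam \<and> design 2 (2 ^ (2 * s)) (2 ^ (2 * s - 1) + 2 ^ k) n {0..<2 ^ (2 * s)}
        (weight_supports pos code (2 ^ (2 * s - 1) + 2 ^ k))"
proof -
  have "(2 :: nat) ^ k \<le> 2 ^ (2 * s - 1)"
    using e k by (intro power_increasing) auto
  moreover have "(2 :: real) ^ (2 * s - 1) = S\<^sup>2 / 2" "(2 :: real) ^ k = S * E / 2"
    using s_pos by (simp_all add: k S E power_diff power_add power_mult mult.commute[of 2])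
  ultimately have weights: "real (2 ^ (2 * s - 1) - 2 ^ k) = (S\<^sup>2 - S * E) / 2"
    "real (2 ^ (2 * s - 1) + 2 ^ k) = (S\<^sup>2 + S * E) / 2"
    by (simp_all add: of_nat_diff diff_divide_distrib add_divide_distrib)
  note design = nonmiddle_weight_design[OF nondeg pos e, folded S E]
  show "\<exists>n. real n = lam \<and> design 2 (2 ^ (2 * s)) (2 ^ (2 * s - 1) - 2 ^ k) n {0..<2 ^ (2 * s)}
        (weight_supports pos code (2 ^ (2 * s - 1) - 2 ^ k))"
    if "lam = rad_count (2 ^ (2 * e)) * ((S\<^sup>2 - S * E) / 2 * ((S\<^sup>2 - S * E) / 2 - 1)) / (E\<^sup>2 * (S\<^sup>2 - 1))"
    by (rule design[where \<epsilon> = 1]) (simp_all only: weights that, simp_all)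
  show "\<exists>n. real n = lam \<and> design 2 (2 ^ (2 * s)) (2 ^ (2 * s - 1) + 2 ^ k) n {0..<2 ^ (2 * s)}
        (weight_supports pos code (2 ^ (2 * s - 1) + 2 ^ k))"
    if "lam = rad_count (2 ^ (2 * e)) * ((S\<^sup>2 + S * E) / 2 * ((S\<^sup>2 + S * E) / 2 - 1)) / (E\<^sup>2 * (S\<^sup>2 - 1))"
    by (rule design[where \<epsilon> = "- 1"]) (simp_all only: weights that, simp_all)
qed

end

theorem theorem7:
  fixes s m l d d' :: nat and pos :: "'a::finite_field \<Rightarrow> nat"
  assumes "s \<ge> 2" and "m = 2 * s" and "CARD('a) = 2 ^ m"
    and "1 \<le> l" and "l \<le> m - 1" and "l \<noteq> s"
    and "d = gcd s l" and "d' = gcd (s + l) (2 * l)"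
    and "bij_betw pos UNIV {0..<2 ^ m}"
  shows
    "(\<forall>i\<ge>1. (\<exists>w \<in> (trace_code s l :: ('a \<Rightarrow> 'a) set). weight w = i) \<longrightarrow>
        t_design 2 {0..<2 ^ m} (weight_supports pos (trace_code s l) i)) \<and>
     (d' = d \<longrightarrow>
       (\<forall>(i, lam) \<in> ({
          (2^(2*s-1) - 2^(s-1),
            2^(s-1) * (2^s - 1) * (2^(2*s-1) - 2^(s-1) - 1)
              * (2^(2*(s+d)) - 2^(2*s+d) - 2^(2*s) + 2^(s+2*d) - 2^(s+d) + 2^(2*d))
              / ((2^(2*d) - 1) * (2^s + 1))),
          (2^(2*s-1) + 2^(s-1),
            2^(s-1) * (2^(2*s-1) + 2^(s-1) - 1)
              * (2^(2*(s+d)) - 2^(2*s+d) - 2^(2*s) + 2^(s+2*d) - 2^(s+d) + 2^(2*d))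
              / (2^(2*d) - 1)),
          (2^(2*s-1) - 2^(s+d-1),
            2^(s-d-1) * (2^(s-d) - 1) * (2^(s+d) - 1) * (2^(2*s-1) - 2^(s+d-1) - 1)
              / (2^(2*d) - 1)),
          (2^(2*s-1) + 2^(s+d-1),
            2^(s-d-1) * (2^(s-d) + 1) * (2^(s+d) - 1) * (2^(2*s-1) + 2^(s+d-1) - 1)
              / (2^(2*d) - 1)),
          (2^(2*s-1),
            (2^(2*s-1) - 1) * (2^(3*s-d) - 2^(2*s-2*d) + 1))
         } :: (nat \<times> real) set).
         \<exists>n::nat. real n = lam \<and>
           design 2 (2 ^ m) i n {0..<2 ^ m} (weight_supports pos (trace_code s l) i))) \<and>
     (d' = 2 * d \<longrightarrow>
       (\<forall>(i, lam) \<in> ({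
          (2^(2*s-1) - 2^(s-1),
            2^(3*d) * (2^(2*s) - 2^(2*(s-d)) - 2^(2*s-3*d) + 2^s - 2^(s-d) + 1)
              * (2^(2*s-1) - 2^(s-1) - 1) * (2^(2*s-1) - 2^(s-1))
              / ((2^(2*d) - 1) * (2^d + 1) * (2^s + 1))),
          (2^(2*s-1) + 2^(s-1),
            2^(3*d) * (2^(2*s) - 2^(2*(s-d)) - 2^(2*s-3*d) + 2^s - 2^(s-d) + 1)
              * (2^(2*s-1) + 2^(s-1) - 1) * (2^(2*s-1) + 2^(s-1))
              / ((2^(2*d) - 1) * (2^d + 1) * (2^s + 1))),
          (2^(2*s-1) - 2^(s+d-1),
            (2^s + 2^(s-d) + 2^(s-2*d) + 1) * (2^(2*s-1) - 2^(s+d-1))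
              * (2^(2*s-1) - 2^(s+d-1) - 1)
              / (2^d * (2^d + 1)^2)),
          (2^(2*s-1) + 2^(s+d-1),
            (2^s + 2^(s-d) + 2^(s-2*d) + 1) * (2^(2*s-1) + 2^(s+d-1))
              * (2^(2*s-1) + 2^(s+d-1) - 1)
              / (2^d * (2^d + 1)^2)),
          (2^(2*s-1),
            (2^(2*s-1) - 1)
              * (2^(3*s-d) - 2^(3*s-2*d) + 2^(3*s-3*d) - 2^(3*s-4*d) + 2^(3*s-5*d)
                 + 2^(2*s-d) - 2^(2*s-2*d+1) + 2^(2*s-3*d) - 2^(2*s-4*d) + 1)),
          (2^(2*s-1) - 2^(s+2*d-1),
            (2^(s-d) - 1) * (2^(2*s-1) - 2^(s+2*d-1)) * (2^(2*s-1) - 2^(s+2*d-1) - 1)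
              / (2^(4*d) * (2^d + 1) * (2^(2*d) - 1))),
          (2^(2*s-1) + 2^(s+2*d-1),
            (2^(s-d) - 1) * (2^(2*s-1) + 2^(s+2*d-1)) * (2^(2*s-1) + 2^(s+2*d-1) - 1)
              / (2^(4*d) * (2^d + 1) * (2^(2*d) - 1)))
         } :: (nat \<times> real) set).
         \<exists>n::nat. real n = lam \<and>
           design 2 (2 ^ m) i n {0..<2 ^ m} (weight_supports pos (trace_code s l) i)))"
proof -
  interpret kasami_code s "TYPE('a)" l
    using assms by unfold_locales auto
  have pos: "bij_betw pos UNIV {0..<2 ^ (2 * s)}"
    using assms(2,9) by simp
  have d: "d = gcd s l" "0 < d" "d < s"
    using assms(7) gcd_less s_pos by simp_all
  \<comment> \<open>In terms of \<open>S\<close> and \<open>D\<close> every claimed parameter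
    becomes a rational function, so the claims reduce to rational identities.\<close>
  define S D :: real where "S = 2 ^ s" and "D = 2 ^ d"
  have SD: "1 < S" "1 < D"
    using d by (simp_all add: S_def D_def one_less_power)
  then have nz: "S - 1 \<noteq> 0" "S + 1 \<noteq> 0" "D - 1 \<noteq> 0" "D + 1 \<noteq> 0" "D \<noteq> 0" "S \<noteq> 0"
    by simp_all
  have sq: "S\<^sup>2 - 1 = (S - 1) * (S + 1)" "D\<^sup>2 - 1 = (D - 1) * (D + 1)"
    by (simp_all add: ring_simps)
  have pw: "(2 :: real) ^ (2 * s) = S\<^sup>2" "(2 :: real) ^ (2 * d) = D\<^sup>2" "(2 :: real) ^ (3 * d) = D ^ 3"
    "(2 :: real) ^ (4 * d) = D ^ 4" "(2 :: real) ^ (5 * d) = D ^ 5" "(2 :: real) ^ (3 * s) = S ^ 3"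
    "(2 :: real) ^ s = S" "(2 :: real) ^ d = D"
    by (simp_all only: S_def D_def power_mult[symmetric] mult.commute)
  \<comment> \<open>The subtractions in the exponents are exact because \<open>0 < d\<close> and
    \<open>d < s\<close>.\<close>
  have pw1: "(2 :: real) ^ (2 * s - 1) = S\<^sup>2 / 2" "(2 :: real) ^ (s - 1) = S / 2"
    "(2 :: real) ^ (s + d - 1) = S * D / 2" "(2 :: real) ^ (s - d - 1) = S / D / 2"
    "(2 :: real) ^ (s - d) = S / D" "(2 :: real) ^ (s + d) = S * D"
    "(2 :: real) ^ (2 * (s + d)) = S\<^sup>2 * D\<^sup>2" "(2 :: real) ^ (2 * s + d) = S\<^sup>2 * D"
    "(2 :: real) ^ (s + 2 * d) = S * D\<^sup>2" "(2 :: real) ^ (3 * s - d) = S ^ 3 / D"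
    "(2 :: real) ^ (2 * s - 2 * d) = S\<^sup>2 / D\<^sup>2"
    using d(2,3) s_pos by (simp_all add: power_diff power_add distrib_left pw)
  show ?thesis
    unfolding assms(2)
  proof (intro conjI impI, goal_cases)
    case 1
    show ?case
      using code_t_design[OF pos] by blast
  next
    case 2
    then have d': "gcd (s + l) (2 * l) = d"
      using assms(8) by simp
    note counts = rad_count_case_one[OF d(1) d']
    note solved = case_one_counts_solved[OF SD(2) counts(1,2)[unfolded pw]]
    note design = signed_weight_design[OF counts(4) pos _ _ S_def]
    note simps = pw pw1 power_0 mult_0_right solved sq
    show ?case
      unfolding ball_simps prod.case
    \<comment> \<open>Cases 1 and 2 belong to the trivial radical, with \<open>e = 0\<close> and
      \<open>E = 1\<close>; cases 3 and 4 to \<open>e = d\<close>; case 5 to vanishing sums.\<close>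
    proof (intro conjI TrueI, goal_cases)
      case 1
      show ?case
        by (rule design(1)[OF s_pos _ refl], simp, simp only: simps)
          (use nz in \<open>simp add: divide_simps\<close>, simp add: ring_simps)
    next
      case 2
      show ?case
        by (rule design(2)[OF s_pos _ refl], simp, simp only: simps)
          (use nz in \<open>simp add: divide_simps\<close>, simp add: ring_simps)
    next
      case 3
      show ?case
        by (rule design(1)[OF d(3) refl D_def], simp only: simps)
          (use nz in \<open>simp add: divide_simps\<close>, simp add: ring_simps)
    next
      case 4
      show ?case
        by (rule design(2)[OF d(3) refl D_def], simp only: simps)
          (use nz in \<open>simp add: divide_simps\<close>, simp add: ring_simps)
    next
      case 5
      show ?case
        by (rule middle_weight_design[OF counts(4) pos _ counts(3)], simp,
            simp only: counts(5) of_nat_1 of_nat_power of_nat_numeral simps)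
          (use nz in \<open>simp add: divide_simps\<close>, simp add: ring_simps)
    qed
  next
    case 3
    then have d': "gcd (s + l) (2 * l) = 2 * d"
      using assms(8) by simp
    have d3: "3 * d \<le> s"
      by (rule three_gcd_le[OF d' d(1)])
    then have d2: "2 * d < s"
      using d(2) by linarith
    \<comment> \<open>Here \<open>3 * d \<le> s\<close> is what makes the subtractions
      exact.\<close>
    have pw2: "(2 :: real) ^ (2 * (s - d)) = S\<^sup>2 / D\<^sup>2" "(2 :: real) ^ (2 * s - 3 * d) = S\<^sup>2 / D ^ 3"
      "(2 :: real) ^ (s - 2 * d) = S / D\<^sup>2" "(2 :: real) ^ (3 * s - 2 * d) = S ^ 3 / D\<^sup>2"
      "(2 :: real) ^ (3 * s - 3 * d) = S ^ 3 / D ^ 3" "(2 :: real) ^ (3 * s - 4 * d) = S ^ 3 / D ^ 4"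
      "(2 :: real) ^ (3 * s - 5 * d) = S ^ 3 / D ^ 5" "(2 :: real) ^ (2 * s - d) = S\<^sup>2 / D"
      "(2 :: real) ^ (2 * s - 2 * d + 1) = 2 * S\<^sup>2 / D\<^sup>2" "(2 :: real) ^ (2 * s - 4 * d) = S\<^sup>2 / D ^ 4"
      "(2 :: real) ^ (s + 2 * d - 1) = S * D\<^sup>2 / 2"
      using d3 d(2,3) s_pos by (simp_all add: power_diff power_add diff_mult_distrib2 pw)
    note counts = rad_count_case_two[OF d(1) d']
    note solved = case_two_counts_solved[OF SD(2) SD(1) counts(1-3)[unfolded pw]]
    note design = signed_weight_design[OF counts(5) pos _ _ S_def]
    have D2: "D\<^sup>2 = 2 ^ (2 * d)"
      by (simp only: pw)
    have e2: "2 * (2 * d) = 4 * d"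
      by simp
    note simps = pw pw1 pw2 power_0 mult_0_right solved sq
    show ?case
      unfolding ball_simps prod.case
    \<comment> \<open>Cases 1 to 5 are as for \<open>d' = d\<close>; cases 6 and 7 belong to radical
      size \<open>2 ^ (4 * d)\<close>, with \<open>e = 2 * d\<close> and
      \<open>E = D\<^sup>2\<close>.\<close>
    proof (intro conjI TrueI, goal_cases)
      case 1
      show ?case
        by (rule design(1)[OF s_pos _ refl], simp, simp only: simps)
          (use nz in \<open>simp add: divide_simps\<close>, simp add: ring_simps)
    next
      case 2
      show ?case
        by (rule design(2)[OF s_pos _ refl], simp, simp only: simps)
          (use nz in \<open>simp add: divide_simps\<close>, simp add: ring_simps)
    next
      case 3
      show ?case
        by (rule design(1)[OF d(3) refl D_def], simp only: simps)
          (use nz in \<open>simp add: divide_simps\<close>, simp add: ring_simps)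
    next
      case 4
      show ?case
        by (rule design(2)[OF d(3) refl D_def], simp only: simps)
          (use nz in \<open>simp add: divide_simps\<close>, simp add: ring_simps)
    next
      case 5
      show ?case
        by (rule middle_weight_design[OF counts(5) pos _ counts(4)], simp,
            simp only: counts(6) of_nat_1 of_nat_power of_nat_numeral pw pw1 pw2)
          (rule case_two_middle[OF SD(2,1) solved(2,1)])
    next
      case 6
      show ?case
        by (rule design(1)[OF d2 refl D2], simp only: e2 simps)
          (use nz in \<open>simp add: divide_simps\<close>)
    next
      case 7
      show ?case
        by (rule design(2)[OF d2 refl D2], simp only: e2 simps)
          (use nz in \<open>simp add: divide_simps\<close>)
    qed
  qed
qed

end
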